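(* Let $R$ be a ring, $S\in\mathrm{Den}_l(R,\mathfrak{a})$, where $\mathfrak{a}$ is a semiprime ideal of $R$, $\overline{R}=R/\mathfrak{a}$ and $\overline{S}=\{s+\mathfrak{a}\mid s\in S\}$. Then: 1. The ring $S^{-1}R\simeq\overline{S}^{-1}\overline{R}$ is a semiprime ring. 2. If, in addition, $|\min(\overline{R})|<\infty$ then $\min(S^{-1}R)=\{S^{-1}\mathfrak{p}=\overline{S}^{-1}\mathfrak{p}\mid\mathfrak{p}\in\min(\overline{R})\}$, i.e. the map $\min(\overline{R})\to\min(S^{-1}R)$, $\mathfrak{p}\mapsto S^{-1}\mathfrak{p}$ is a bijection and $|\min(S^{-1}R)|=|\min(\overline{R})|$. 3. If, in addition, $|\min(\overline{R})|<\infty$ then for each $\mathfrak{p}\in\min(\overline{R})$, $\pi_{\mathfrak{p}}(\overline{S})\in\mathrm{Den}_l(\overline{R}/\mathfrak{p},0)$ and $\pi_{\mathfrak{p}}(\overline{S})^{-1}(\overline{R}/\mathfrak{p})\simeq\overline{S}^{-1}\overline{R}/\overline{S}^{-1}\mathfrak{p}\simeq\overline{S}^{-1}(\overline{R}/\mathfrak{p})$, where $\pi_{\mathfrak{p}}:\overline{R}\to\overline{R}/\mathfrak{p}$, $r\mapsto r+\mathfrak{p}$.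
   Context: Rings are associative with $1$. A multiplicative subset $S$ of $R$ is a multiplicative subsemigroup with $1\in S$, $0\notin S$. It is a left Ore set if $Sr\cap Rs\neq\emptyset$ for all $r\in R$, $s\in S$; then $\mathrm{ass}_l(S)=\{r\in R\mid sr=0 \text{ for some } s\in S\}$ is an ideal. A left Ore set $S$ is a left denominator set if $rs=0$ with $r\in R$, $s\in S$ implies $tr=0$ for some $t\in S$. $\mathrm{Den}_l(R,\mathfrak{a})$ is the set of left denominator sets $S$ of $R$ with $\mathrm{ass}_l(S)=\mathfrak{a}$. $S^{-1}R=\{s^{-1}r\mid s\in S,r\in R\}$ is the left localization; there is a natural $R$-isomorphism $S^{-1}R\simeq\overline{S}^{-1}\overline{R}$, by which these are identified. For an ideal $\mathfrak{p}$ of $\overline{R}$, $\overline{S}^{-1}\mathfrak{p}=\{s^{-1}p\mid s\in\overline{S},p\in\mathfrak{p}\}$, also written $S^{-1}\mathfrak{p}$; $\overline{S}^{-1}(\overline{R}/\mathfrak{p})$ is the localization of the left module $\overline{R}/\mathfrak{p}$. A ring is semiprime if the intersection of its prime ideals is zero; an ideal $\mathfrak{a}$ is semiprime if $R/\mathfrak{a}$ is a semiprime ring. $\min(R)$ is the set of minimal primes of $R$. *)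

theory Defs
  imports "HOL-Algebra.Ideal_Product" "HOL-Algebra.QuotRing" "HOL-Algebra.Module"
begin

section \<open>Prime ideals and semiprime rings\<close>

text \<open>
  The library's \<^const>\<open>primeideal\<close> is restricted to commutative rings and is the
  elementwise (completely prime) notion, so the noncommutative one is defined here.
\<close>

definition prime_ideal :: "('a, 'm) ring_scheme \<Rightarrow> 'a set \<Rightarrow> bool" where
  "prime_ideal R P \<longleftrightarrow> ideal P R \<and> P \<noteq> carrier R \<and>
     (\<forall>I J. ideal I R \<longrightarrow> ideal J R \<longrightarrow> I \<cdot>\<^bsub>R\<^esub> J \<subseteq> P \<longrightarrow> I \<subseteq> P \<or> J \<subseteq> P)"

definition min_primes :: "('a, 'm) ring_scheme \<Rightarrow> 'a set set" where
  "min_primes R = {P. prime_ideal R P \<and> (\<forall>Q. prime_ideal R Q \<longrightarrow> Q \<subseteq> P \<longrightarrow> Q = P)}"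

definition semiprime_ring :: "('a, 'm) ring_scheme \<Rightarrow> bool" where
  "semiprime_ring R \<longleftrightarrow> ring R \<and> carrier R \<inter> \<Inter>{P. prime_ideal R P} = {\<zero>\<^bsub>R\<^esub>}"

definition semiprime_ideal :: "('a, 'm) ring_scheme \<Rightarrow> 'a set \<Rightarrow> bool" where
  "semiprime_ideal R I \<longleftrightarrow> ideal I R \<and> semiprime_ring (R Quot I)"


section \<open>Left denominator sets\<close>

definition multiplicative_subset :: "('a, 'm) ring_scheme \<Rightarrow> 'a set \<Rightarrow> bool" where
  "multiplicative_subset R S \<longleftrightarrow> submonoid S R \<and> \<zero>\<^bsub>R\<^esub> \<notin> S"

text \<open>Here \<open>S #> r\<close> is the set \<open>S r\<close> and \<open>carrier R #> s\<close> is \<open>R s\<close>.\<close>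

definition left_Ore_set :: "('a, 'm) ring_scheme \<Rightarrow> 'a set \<Rightarrow> bool" where
  "left_Ore_set R S \<longleftrightarrow> multiplicative_subset R S \<and>
     (\<forall>r\<in>carrier R. \<forall>s\<in>S. (S #>\<^bsub>R\<^esub> r) \<inter> (carrier R #>\<^bsub>R\<^esub> s) \<noteq> {})"

definition ass_l :: "('a, 'm) ring_scheme \<Rightarrow> 'a set \<Rightarrow> 'a set" where
  "ass_l R S = {r \<in> carrier R. \<exists>s\<in>S. s \<otimes>\<^bsub>R\<^esub> r = \<zero>\<^bsub>R\<^esub>}"

definition left_denominator_set :: "('a, 'm) ring_scheme \<Rightarrow> 'a set \<Rightarrow> bool" where
  "left_denominator_set R S \<longleftrightarrow> left_Ore_set R S \<and>
     (\<forall>r\<in>carrier R. \<forall>s\<in>S. r \<otimes>\<^bsub>R\<^esub> s = \<zero>\<^bsub>R\<^esub> \<longrightarrow> (\<exists>t\<in>S. t \<otimes>\<^bsub>R\<^esub> r = \<zero>\<^bsub>R\<^esub>))"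

definition Den_l :: "('a, 'm) ring_scheme \<Rightarrow> 'a set \<Rightarrow> 'a set set" where
  "Den_l R I = {S. left_denominator_set R S \<and> ass_l R S = I}"


section \<open>Left modules\<close>

text \<open>
  The library's \<^locale>\<open>module\<close> requires a commutative ring of scalars. We keep its record type;
  the fields \<^const>\<open>mult\<close> and \<^const>\<open>one\<close>, inherited from the ring record, carry no meaning
  for a module.
\<close>

locale left_module = R?: ring + M?: abelian_group M for M (structure) +
  assumes smult_closed:
      "\<lbrakk>a \<in> carrier R; x \<in> carrier M\<rbrakk> \<Longrightarrow> a \<odot>\<^bsub>M\<^esub> x \<in> carrier M"
    and smult_l_distr:
      "\<lbrakk>a \<in> carrier R; b \<in> carrier R; x \<in> carrier M\<rbrakk> \<Longrightarrow>
        (a \<oplus> b) \<odot>\<^bsub>M\<^esub> x = a \<odot>\<^bsub>M\<^esub> x \<oplus>\<^bsub>M\<^esub> b \<odot>\<^bsub>M\<^esub> x"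
    and smult_r_distr:
      "\<lbrakk>a \<in> carrier R; x \<in> carrier M; y \<in> carrier M\<rbrakk> \<Longrightarrow>
        a \<odot>\<^bsub>M\<^esub> (x \<oplus>\<^bsub>M\<^esub> y) = a \<odot>\<^bsub>M\<^esub> x \<oplus>\<^bsub>M\<^esub> a \<odot>\<^bsub>M\<^esub> y"
    and smult_assoc:
      "\<lbrakk>a \<in> carrier R; b \<in> carrier R; x \<in> carrier M\<rbrakk> \<Longrightarrow>
        (a \<otimes> b) \<odot>\<^bsub>M\<^esub> x = a \<odot>\<^bsub>M\<^esub> (b \<odot>\<^bsub>M\<^esub> x)"
    and smult_one:
      "x \<in> carrier M \<Longrightarrow> \<one> \<odot>\<^bsub>M\<^esub> x = x"

definition left_module_iso ::
    "('a, 'm) ring_scheme \<Rightarrow> ('a, 'b, 'n) module_scheme \<Rightarrow> ('a, 'c, 'k) module_scheme \<Rightarrow> ('b \<Rightarrow> 'c) set"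
  where "left_module_iso R M N = {h. left_module R M \<and> left_module R N \<and>
     bij_betw h (carrier M) (carrier N) \<and>
     (\<forall>x\<in>carrier M. \<forall>y\<in>carrier M. h (x \<oplus>\<^bsub>M\<^esub> y) = h x \<oplus>\<^bsub>N\<^esub> h y) \<and>
     (\<forall>a\<in>carrier R. \<forall>x\<in>carrier M. h (a \<odot>\<^bsub>M\<^esub> x) = a \<odot>\<^bsub>N\<^esub> h x)}"

definition regular_module :: "('a, 'm) ring_scheme \<Rightarrow> ('a, 'a) module" where
  "regular_module R = \<lparr>carrier = carrier R, mult = mult R, one = one R, zero = zero R, add = add R,
     smult = mult R\<rparr>"

definition quotient_module :: "('a, 'm) ring_scheme \<Rightarrow> 'a set \<Rightarrow> ('a, 'a set) module" where
  "quotient_module R I = \<lparr>carrier = carrier (R Quot I), mult = mult (R Quot I), one = one (R Quot I),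
     zero = zero (R Quot I), add = add (R Quot I),
     smult = (\<lambda>r X. (I +>\<^bsub>R\<^esub> r) \<otimes>\<^bsub>R Quot I\<^esub> X)\<rparr>"


section \<open>Left localization\<close>

text \<open>
  \<open>mfrac R S M s m\<close> is the fraction \<open>s\<^sup>-\<^sup>1 m\<close> in \<open>S\<^sup>-\<^sup>1 M\<close>: the class of \<open>(s, m)\<close>
  for the relation on \<open>S \<times> M\<close> that identifies \<open>(s, m)\<close> and \<open>(t, n)\<close> if
  \<open>c s = d t \<in> S\<close> and \<open>c m = d n\<close> for some \<open>c, d \<in> R\<close>.
\<close>

definition mfrac :: "('a, 'm) ring_scheme \<Rightarrow> 'a set \<Rightarrow> ('a, 'b, 'n) module_scheme
    \<Rightarrow> 'a \<Rightarrow> 'b \<Rightarrow> ('a \<times> 'b) set" where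
  "mfrac R S M s m = {(t, n). t \<in> S \<and> n \<in> carrier M \<and>
     (\<exists>c\<in>carrier R. \<exists>d\<in>carrier R.
        c \<otimes>\<^bsub>R\<^esub> s \<in> S \<and> c \<otimes>\<^bsub>R\<^esub> s = d \<otimes>\<^bsub>R\<^esub> t \<and> c \<odot>\<^bsub>M\<^esub> m = d \<odot>\<^bsub>M\<^esub> n)}"

text \<open>
  The operations are given by
  \<open>s\<^sup>-\<^sup>1 m + t\<^sup>-\<^sup>1 n = (c s)\<^sup>-\<^sup>1 (c m + d n)\<close> for \<open>c s = d t \<in> S\<close>, and
  \<open>s\<^sup>-\<^sup>1 a \<cdot> t\<^sup>-\<^sup>1 n = (u s)\<^sup>-\<^sup>1 (c n)\<close> for \<open>u a = c t\<close> with \<open>u \<in> S\<close>.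
  As in \<^const>\<open>rcoset_mult\<close>, the union is over all choices of representatives and of \<open>c, d, u\<close>;
  all of them yield the same class when \<open>S\<close> is a left denominator set.
\<close>

definition mloc_add :: "('a, 'm) ring_scheme \<Rightarrow> 'a set \<Rightarrow> ('a, 'b, 'n) module_scheme
    \<Rightarrow> ('a \<times> 'b) set \<Rightarrow> ('a \<times> 'b) set \<Rightarrow> ('a \<times> 'b) set" where
  "mloc_add R S M X Y =
     \<Union>{mfrac R S M (c \<otimes>\<^bsub>R\<^esub> s) (c \<odot>\<^bsub>M\<^esub> m \<oplus>\<^bsub>M\<^esub> d \<odot>\<^bsub>M\<^esub> n) | s m t n c d.
        (s, m) \<in> X \<and> (t, n) \<in> Y \<and> c \<in> carrier R \<and> d \<in> carrier R \<and>
        c \<otimes>\<^bsub>R\<^esub> s \<in> S \<and> c \<otimes>\<^bsub>R\<^esub> s = d \<otimes>\<^bsub>R\<^esub> t}"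

definition mloc_smult :: "('a, 'm) ring_scheme \<Rightarrow> 'a set \<Rightarrow> ('a, 'b, 'n) module_scheme
    \<Rightarrow> ('a \<times> 'a) set \<Rightarrow> ('a \<times> 'b) set \<Rightarrow> ('a \<times> 'b) set" where
  "mloc_smult R S M X Y =
     \<Union>{mfrac R S M (u \<otimes>\<^bsub>R\<^esub> s) (c \<odot>\<^bsub>M\<^esub> n) | s a t n u c.
        (s, a) \<in> X \<and> (t, n) \<in> Y \<and> u \<in> S \<and> c \<in> carrier R \<and> u \<otimes>\<^bsub>R\<^esub> a = c \<otimes>\<^bsub>R\<^esub> t}"

definition left_loc_module :: "('a, 'm) ring_scheme \<Rightarrow> 'a set \<Rightarrow> ('a, 'b, 'n) module_scheme
    \<Rightarrow> (('a \<times> 'a) set, ('a \<times> 'b) set) module" where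
  "left_loc_module R S M =
     \<lparr>carrier = {mfrac R S M s m | s m. s \<in> S \<and> m \<in> carrier M},
      mult = undefined, one = undefined,
      zero = mfrac R S M \<one>\<^bsub>R\<^esub> \<zero>\<^bsub>M\<^esub>,
      add = mloc_add R S M,
      smult = mloc_smult R S M\<rparr>"

abbreviation frac :: "('a, 'm) ring_scheme \<Rightarrow> 'a set \<Rightarrow> 'a \<Rightarrow> 'a \<Rightarrow> ('a \<times> 'a) set" where
  "frac R S s r \<equiv> mfrac R S (regular_module R) s r"

definition left_loc :: "('a, 'm) ring_scheme \<Rightarrow> 'a set \<Rightarrow> ('a \<times> 'a) set ring" where
  "left_loc R S =
     \<lparr>carrier = {frac R S s r | s r. s \<in> S \<and> r \<in> carrier R},
      mult = mloc_smult R S (regular_module R),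
      one = frac R S \<one>\<^bsub>R\<^esub> \<one>\<^bsub>R\<^esub>,
      zero = frac R S \<one>\<^bsub>R\<^esub> \<zero>\<^bsub>R\<^esub>,
      add = mloc_add R S (regular_module R)\<rparr>"

definition loc_ideal :: "('a, 'm) ring_scheme \<Rightarrow> 'a set \<Rightarrow> 'a set \<Rightarrow> ('a \<times> 'a) set set" where
  "loc_ideal R S P = {frac R S s p | s p. s \<in> S \<and> p \<in> P}"

text \<open>
  The natural map \<open>s\<^sup>-\<^sup>1 r \<mapsto> (s + I)\<^sup>-\<^sup>1 (r + I)\<close> from \<open>S\<^sup>-\<^sup>1 R\<close> to the localization of
  \<open>R/I\<close> at the image of \<open>S\<close>. For \<open>I = ass_l R S\<close> it is the isomorphism by which the two rings
  are identified; \<open>loc_ideal_pull\<close> transports the localization of an ideal of \<open>R/I\<close> to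
  an ideal of \<open>S\<^sup>-\<^sup>1 R\<close> along it.
\<close>

definition loc_quot_map :: "('a, 'm) ring_scheme \<Rightarrow> 'a set \<Rightarrow> 'a set
    \<Rightarrow> ('a \<times> 'a) set \<Rightarrow> ('a set \<times> 'a set) set" where
  "loc_quot_map R S I X =
     \<Union>{frac (R Quot I) ((\<lambda>s. I +>\<^bsub>R\<^esub> s) ` S) (I +>\<^bsub>R\<^esub> s) (I +>\<^bsub>R\<^esub> r) | s r. (s, r) \<in> X}"

definition loc_ideal_pull :: "('a, 'm) ring_scheme \<Rightarrow> 'a set \<Rightarrow> 'a set
    \<Rightarrow> 'a set set \<Rightarrow> ('a \<times> 'a) set set" where
  "loc_ideal_pull R S I P =
     {X \<in> carrier (left_loc R S).
        loc_quot_map R S I X \<in> loc_ideal (R Quot I) ((\<lambda>s. I +>\<^bsub>R\<^esub> s) ` S) P}"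

end

theory Submission
  imports Defs
begin

text \<open>
  Passing to \<open>R/I\<close> and the image of \<open>S\<close>, all elements of \<open>S\<close> become regular. If \<open>P\<close> is a prime of a
  semiprime ring \<open>R\<close>, its complement is an m-system of \<open>R\<close> whose image in \<open>S\<^sup>-\<^sup>1 R\<close> is again an
  m-system, so it is avoided by a prime of \<open>S\<^sup>-\<^sup>1 R\<close>; hence \<open>S\<^sup>-\<^sup>1 R\<close> is semiprime.
  If there are only finitely many minimal primes, each of them is both the left and the right
  annihilator of the intersection of the others, so \<open>S\<close> stays regular modulo \<open>P\<close>. Then
  \<open>S\<^sup>-\<^sup>1 P\<close> is the kernel of the map from \<open>S\<^sup>-\<^sup>1 R\<close> to the localization of \<open>R/P\<close>, it is prime and
  contracts to \<open>P\<close>; as the finitely many \<open>S\<^sup>-\<^sup>1 P\<close> meet in zero, every prime of \<open>S\<^sup>-\<^sup>1 R\<close> contains one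
  of them.
\<close>

section \<open>Modules of fractions\<close>

text \<open>The obstacle is that the left fractions with numerator in an ideal \<open>P\<close> need
  not visibly form a two-sided ideal. To multiply \<open>s^-1 p\<close> by \<open>t^-1\<close> on
  the right one chooses \<open>u p = c t\<close> with \<open>u\<close> in \<open>S\<close>, and
  \<open>c\<close> lies in \<open>P\<close> as soon as \<open>t\<close> can be cancelled on the
  right modulo \<open>P\<close>. For an arbitrary prime nothing provides this, which is why
  semiprimeness is proved with m-systems and never mentions \<open>loc_ideal R S P\<close>.
  Regularity of \<open>S\<close> on both sides modulo an ideal \<open>J\<close> is therefore
  isolated as the locale \<open>left_den_quotient\<close>. It is used at two levels: in
  \<open>R\<close> with \<open>J = ass_l R S\<close>, where it yields the identification of the two
  rings of fractions, and in \<open>R/I\<close> with \<open>J\<close> a minimal prime, where it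
  yields the ideal, its primeness and the isomorphisms. The ring of fractions is treated as the
  localization of the regular module, so that ring and modules share the proofs that the operations
  are well defined.\<close>

lemma regular_module_simps [simp]:
  "carrier (regular_module R) = carrier R"
  "zero (regular_module R) = zero R"
  "add (regular_module R) = add R"
  "smult (regular_module R) = mult R"
  by (simp_all add: regular_module_def)

text \<open>The operations on fractions are unions over all choices of representatives and
  multipliers. To evaluate one, it suffices to exhibit one choice and to show that every other
  choice gives the same class.\<close>

lemma Union_eq_witness:
  assumes "A \<in> \<A>" "\<And>B. B \<in> \<A> \<Longrightarrow> B = A" shows "\<Union>\<A> = A"
  using assms by blast

lemma (in ring) left_module_regular: "left_module R (regular_module R)"
proof -
  have "abelian_group (regular_module R)"
    by (rule abelian_groupI) (auto simp: a_ac intro: bexI[of _ "\<ominus> _"] l_neg)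
  then show ?thesis
    by (auto simp: left_module_def left_module_axioms_def ring_axioms l_distr r_distr m_assoc)
qed

section \<open>Left denominator sets and equality of fractions\<close>

locale left_den = ring R for R (structure) +
  fixes S
  assumes den: "left_denominator_set R S"
begin

lemma mult_subset: "submonoid S R" and zero_notin: "\<zero> \<notin> S"
  using den by (auto simp: left_denominator_set_def left_Ore_set_def multiplicative_subset_def)

lemma S_carrier [simp, intro]: "s \<in> S \<Longrightarrow> s \<in> carrier R"
  using submonoid.mem_carrier[OF mult_subset] .

lemma S_one [simp, intro]: "\<one> \<in> S"
  using submonoid.one_closed[OF mult_subset] .

lemma S_mult [simp, intro]: "\<lbrakk>s \<in> S; t \<in> S\<rbrakk> \<Longrightarrow> s \<otimes> t \<in> S"
  using submonoid.m_closed[OF mult_subset] .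

lemma Ore:
  assumes "r \<in> carrier R" "s \<in> S"
  obtains u c where "u \<in> S" "c \<in> carrier R" "u \<otimes> r = c \<otimes> s"
  using assms den unfolding left_denominator_set_def left_Ore_set_def r_coset_def by fast

lemma annihilator_right:
  assumes "r \<in> carrier R" "s \<in> S" "r \<otimes> s = \<zero>"
  obtains t where "t \<in> S" "t \<otimes> r = \<zero>"
  using assms den unfolding left_denominator_set_def by blast

text \<open>The denominator condition for \<open>a \<ominus> b\<close>: a right factor from
  \<open>S\<close> is cancelled at the price of a left factor from \<open>S\<close>. This is the
  source of \<open>z1\<close> and \<open>z2\<close> in \<open>mfrac_transfer\<close>.\<close>

lemma right_cancel:
  assumes "a \<in> carrier R" "b \<in> carrier R" "s \<in> S" "a \<otimes> s = b \<otimes> s"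
  obtains t where "t \<in> S" "t \<otimes> a = t \<otimes> b"
proof -
  have "(a \<ominus> b) \<otimes> s = \<zero>"
    using assms by (simp add: a_minus_def l_distr l_minus r_neg)
  then obtain t where t: "t \<in> S" "t \<otimes> (a \<ominus> b) = \<zero>"
    using assms annihilator_right[of "a \<ominus> b" s] by auto
  then have "t \<otimes> a \<oplus> \<ominus> (t \<otimes> b) = \<zero>"
    using assms by (simp add: a_minus_def r_distr r_minus)
  then have "t \<otimes> a = t \<otimes> b"
    using assms t by (metis S_carrier m_closed a_inv_closed minus_equality minus_minus)
  then show thesis using that t by blast
qed

text \<open>The Ore condition is used with \<open>s\<close> as the ring element, so the multiplier
  of \<open>s\<close> comes from \<open>S\<close> and the common multiple is again a denominator,
  while \<open>d\<close> is only an element of \<open>R\<close>.\<close>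

lemma common_left_multiple:
  assumes "s \<in> S" "t \<in> S"
  obtains c d where "c \<in> carrier R" "d \<in> carrier R" "c \<otimes> s \<in> S" "c \<otimes> s = d \<otimes> t" "c \<in> S"
  using Ore[of s t] assms by (metis S_carrier S_mult)

end

locale left_den_module = left_den R S + left_module R M for R (structure) and S and M
begin

lemma mfracI:
  assumes "c \<otimes> s \<in> S" "c \<otimes> s = d \<otimes> t" "c \<odot>\<^bsub>M\<^esub> m = d \<odot>\<^bsub>M\<^esub> n"
    "t \<in> S" "n \<in> carrier M" "c \<in> carrier R" "d \<in> carrier R"
  shows "(t, n) \<in> mfrac R S M s m"
  using assms unfolding mfrac_def by blast

lemma mfracE:
  assumes "(t, n) \<in> mfrac R S M s m"
  obtains c d where "c \<otimes> s \<in> S" "c \<otimes> s = d \<otimes> t" "c \<odot>\<^bsub>M\<^esub> m = d \<odot>\<^bsub>M\<^esub> n"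
    "t \<in> S" "n \<in> carrier M" "c \<in> carrier R" "d \<in> carrier R"
  using assms unfolding mfrac_def by blast

lemma mfrac_sym:
  assumes "(t, n) \<in> mfrac R S M s m" "s \<in> S" "m \<in> carrier M"
  shows "(s, m) \<in> mfrac R S M t n"
  using assms(1) by (rule mfracE) (use assms(2-) in \<open>metis mfracI\<close>)

text \<open>The element \<open>e t = e' t'\<close> need not lie in \<open>S\<close>; this is what makes products of fractions
  independent of the representatives.\<close>

lemma mfrac_transfer:
  assumes rel: "(t', n') \<in> mfrac R S M t n"
    and [simp]: "t \<in> S" "n \<in> carrier M" "e \<in> carrier R" "e' \<in> carrier R"
    and eq: "e \<otimes> t = e' \<otimes> t'"
  obtains z where "z \<in> S" "(z \<otimes> e) \<odot>\<^bsub>M\<^esub> n = (z \<otimes> e') \<odot>\<^bsub>M\<^esub> n'"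
proof -
  obtain h h' where [simp]: "t' \<in> S" "n' \<in> carrier M" "h \<in> carrier R" "h' \<in> carrier R"
    and ht: "h \<otimes> t \<in> S" "h \<otimes> t = h' \<otimes> t'" and hn: "h \<odot>\<^bsub>M\<^esub> n = h' \<odot>\<^bsub>M\<^esub> n'"
    by (rule mfracE[OF rel])
  have [simp]: "h' \<otimes> t' \<in> S" using ht by simp
  \<comment> \<open>Since \<open>h \<otimes> t\<close> lies in \<open>S\<close>, Ore expresses a
    multiple of \<open>e \<otimes> t\<close> through the given relation. Cancelling \<open>t\<close>
    costs \<open>z1\<close>, cancelling \<open>t'\<close> costs \<open>z2\<close>, and a common left
    multiple of the two serves both identities.\<close>
  obtain x y where [simp]: "x \<in> S" "y \<in> carrier R" and xy: "x \<otimes> (e \<otimes> t) = y \<otimes> (h \<otimes> t)"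
    using Ore[of "e \<otimes> t" "h \<otimes> t"] ht by auto
  obtain z1 where [simp]: "z1 \<in> S" and z1: "z1 \<otimes> (x \<otimes> e) = z1 \<otimes> (y \<otimes> h)"
    using right_cancel[of "x \<otimes> e" "y \<otimes> h" t] xy by (auto simp: m_assoc)
  have "(x \<otimes> e') \<otimes> t' = (y \<otimes> h') \<otimes> t'"
    using xy ht(2) eq by (simp add: m_assoc)
  then obtain z2 where [simp]: "z2 \<in> S" and z2: "z2 \<otimes> (x \<otimes> e') = z2 \<otimes> (y \<otimes> h')"
    using right_cancel[of "x \<otimes> e'" "y \<otimes> h'" t'] by auto
  obtain c d where [simp]: "c \<in> carrier R" "d \<in> carrier R" and cd: "c \<otimes> z1 \<in> S" "c \<otimes> z1 = d \<otimes> z2"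
    using common_left_multiple[of z1 z2] by (metis \<open>z1 \<in> S\<close> \<open>z2 \<in> S\<close>)
  have "((c \<otimes> z1) \<otimes> x \<otimes> e) \<odot>\<^bsub>M\<^esub> n = (c \<otimes> (z1 \<otimes> (x \<otimes> e))) \<odot>\<^bsub>M\<^esub> n"
    by (simp add: m_assoc)
  also have "\<dots> = (c \<otimes> z1 \<otimes> y) \<odot>\<^bsub>M\<^esub> (h \<odot>\<^bsub>M\<^esub> n)"
    unfolding z1 by (simp add: m_assoc smult_assoc[symmetric])
  also have "\<dots> = (d \<otimes> (z2 \<otimes> (y \<otimes> h'))) \<odot>\<^bsub>M\<^esub> n'"
    unfolding hn cd(2) by (simp add: m_assoc smult_assoc[symmetric])
  also have "\<dots> = ((d \<otimes> z2) \<otimes> x \<otimes> e') \<odot>\<^bsub>M\<^esub> n'"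
    unfolding z2[symmetric] by (simp add: m_assoc)
  finally show thesis
    using that[of "c \<otimes> z1 \<otimes> x"] cd by (metis S_mult \<open>x \<in> S\<close>)
qed

text \<open>The middle values \<open>d \<otimes> t\<close> and \<open>e \<otimes> t\<close> both lie
  in \<open>S\<close>, so Ore aligns them, and \<open>mfrac_transfer\<close> then compares
  \<open>n\<close> with \<open>p\<close>. The final denominator stays in \<open>S\<close> because
  \<open>z\<close>, \<open>x\<close> and \<open>c \<otimes> s\<close> do, even if \<open>c\<close>
  does not.\<close>

lemma mfrac_trans:
  assumes st: "(t, n) \<in> mfrac R S M s m" and tv: "(v, p) \<in> mfrac R S M t n"
    and [simp]: "s \<in> S" "m \<in> carrier M"
  shows "(v, p) \<in> mfrac R S M s m"
proof -
  obtain c d where [simp]: "t \<in> S" "n \<in> carrier M" "c \<in> carrier R" "d \<in> carrier R"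
    and c: "c \<otimes> s \<in> S" "c \<otimes> s = d \<otimes> t" "c \<odot>\<^bsub>M\<^esub> m = d \<odot>\<^bsub>M\<^esub> n"
    by (rule mfracE[OF st])
  obtain e f where [simp]: "v \<in> S" "p \<in> carrier M" "e \<in> carrier R" "f \<in> carrier R"
    and e: "e \<otimes> t \<in> S" "e \<otimes> t = f \<otimes> v"
    by (rule mfracE[OF tv])
  obtain x y where [simp]: "x \<in> S" "y \<in> carrier R" and xy: "x \<otimes> (d \<otimes> t) = y \<otimes> (e \<otimes> t)"
    using Ore[of "d \<otimes> t" "e \<otimes> t"] e by auto
  have xv: "(x \<otimes> d) \<otimes> t = (y \<otimes> f) \<otimes> v"
    using xy e by (simp add: m_assoc)
  obtain z where [simp]: "z \<in> S" and z: "(z \<otimes> (x \<otimes> d)) \<odot>\<^bsub>M\<^esub> n = (z \<otimes> (y \<otimes> f)) \<odot>\<^bsub>M\<^esub> p"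
    using mfrac_transfer[OF tv _ _ _ _ xv] by auto
  have xc: "(z \<otimes> x \<otimes> c) \<otimes> s = (z \<otimes> x) \<otimes> (c \<otimes> s)"
    by (simp add: m_assoc)
  show ?thesis
  proof (rule mfracI[of "z \<otimes> x \<otimes> c" _ "z \<otimes> y \<otimes> f"])
    show "(z \<otimes> x \<otimes> c) \<otimes> s \<in> S" unfolding xc by (rule S_mult[OF S_mult[OF \<open>z \<in> S\<close> \<open>x \<in> S\<close>] c(1)])
    show "(z \<otimes> x \<otimes> c) \<otimes> s = (z \<otimes> y \<otimes> f) \<otimes> v"
      unfolding xc c using xv by (simp add: m_assoc)
    have "(z \<otimes> x \<otimes> c) \<odot>\<^bsub>M\<^esub> m = (z \<otimes> x) \<odot>\<^bsub>M\<^esub> (c \<odot>\<^bsub>M\<^esub> m)"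
      by (simp add: smult_assoc)
    also have "\<dots> = (z \<otimes> (x \<otimes> d)) \<odot>\<^bsub>M\<^esub> n"
      unfolding c by (simp add: smult_assoc[symmetric] m_assoc)
    finally show "(z \<otimes> x \<otimes> c) \<odot>\<^bsub>M\<^esub> m = (z \<otimes> y \<otimes> f) \<odot>\<^bsub>M\<^esub> p"
      unfolding z by (simp add: m_assoc)
  qed auto
qed

lemma mfrac_self: "s \<in> S \<Longrightarrow> m \<in> carrier M \<Longrightarrow> (s, m) \<in> mfrac R S M s m"
  by (rule mfracI[of \<one> _ \<one>]) auto

lemma mem_mfracD: "(t, n) \<in> mfrac R S M s m \<Longrightarrow> t \<in> S \<and> n \<in> carrier M"
  unfolding mfrac_def by blast

lemma mfrac_eq_iff:
  assumes "s \<in> S" "m \<in> carrier M" "t \<in> S" "n \<in> carrier M"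
  shows "mfrac R S M s m = mfrac R S M t n \<longleftrightarrow> (t, n) \<in> mfrac R S M s m"
proof
  assume "(t, n) \<in> mfrac R S M s m"
  then show "mfrac R S M s m = mfrac R S M t n"
    using assms mfrac_sym[of t n s m] mfrac_trans[of t n s m] mfrac_trans[of s m t n] by auto
qed (use mfrac_self assms in simp)

lemma mfrac_eqD:
  assumes "mfrac R S M s m = mfrac R S M t n" "e \<otimes> s = f \<otimes> t"
    "s \<in> S" "m \<in> carrier M" "t \<in> S" "n \<in> carrier M" "e \<in> carrier R" "f \<in> carrier R"
  obtains z where "z \<in> S" "(z \<otimes> e) \<odot>\<^bsub>M\<^esub> m = (z \<otimes> f) \<odot>\<^bsub>M\<^esub> n"
  using mfrac_transfer[of t n s m e f] assms mfrac_eq_iff[of s m t n] by blast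

lemma mfrac_scale:
  assumes "c \<otimes> s \<in> S" "s \<in> S" "c \<in> carrier R" "m \<in> carrier M"
  shows "mfrac R S M (c \<otimes> s) (c \<odot>\<^bsub>M\<^esub> m) = mfrac R S M s m"
  using assms mfracI[of \<one> "c \<otimes> s" c s "c \<odot>\<^bsub>M\<^esub> m" m] by (simp add: mfrac_eq_iff smult_closed smult_one)

lemma mfrac_same_denominator:
  assumes [simp]: "s \<in> S" "m \<in> carrier M" "n \<in> carrier M"
  shows "mfrac R S M s m = mfrac R S M s n \<longleftrightarrow> (\<exists>u\<in>S. u \<odot>\<^bsub>M\<^esub> m = u \<odot>\<^bsub>M\<^esub> n)"
proof
  assume "mfrac R S M s m = mfrac R S M s n"
  then obtain z where "z \<in> S" "(z \<otimes> \<one>) \<odot>\<^bsub>M\<^esub> m = (z \<otimes> \<one>) \<odot>\<^bsub>M\<^esub> n"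
    using mfrac_eqD[of s m s n \<one> \<one>] by (metis assms one_closed)
  then show "\<exists>u\<in>S. u \<odot>\<^bsub>M\<^esub> m = u \<odot>\<^bsub>M\<^esub> n" by auto
next
  assume "\<exists>u\<in>S. u \<odot>\<^bsub>M\<^esub> m = u \<odot>\<^bsub>M\<^esub> n"
  then obtain u where "u \<in> S" "u \<odot>\<^bsub>M\<^esub> m = u \<odot>\<^bsub>M\<^esub> n" by blast
  then show "mfrac R S M s m = mfrac R S M s n"
    using mfrac_scale[of u s m] mfrac_scale[of u s n] by simp
qed

lemma smult_zero [simp]:
  assumes "a \<in> carrier R" shows "a \<odot>\<^bsub>M\<^esub> \<zero>\<^bsub>M\<^esub> = \<zero>\<^bsub>M\<^esub>"
proof -
  have "a \<odot>\<^bsub>M\<^esub> \<zero>\<^bsub>M\<^esub> \<oplus>\<^bsub>M\<^esub> a \<odot>\<^bsub>M\<^esub> \<zero>\<^bsub>M\<^esub> = a \<odot>\<^bsub>M\<^esub> \<zero>\<^bsub>M\<^esub> \<oplus>\<^bsub>M\<^esub> \<zero>\<^bsub>M\<^esub>"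
    using assms by (simp add: smult_r_distr[symmetric] smult_closed)
  then show ?thesis using assms smult_closed[of a "\<zero>\<^bsub>M\<^esub>"] by simp
qed

lemma mfrac_zero:
  assumes "s \<in> S" shows "mfrac R S M s \<zero>\<^bsub>M\<^esub> = mfrac R S M \<one> \<zero>\<^bsub>M\<^esub>"
  using mfrac_scale[of s \<one> "\<zero>\<^bsub>M\<^esub>"] assms by simp

lemma mfrac_eq_zero_iff:
  assumes "s \<in> S" "m \<in> carrier M"
  shows "mfrac R S M s m = mfrac R S M \<one> \<zero>\<^bsub>M\<^esub> \<longleftrightarrow> (\<exists>u\<in>S. u \<odot>\<^bsub>M\<^esub> m = \<zero>\<^bsub>M\<^esub>)"
proof -
  have "mfrac R S M s m = mfrac R S M s \<zero>\<^bsub>M\<^esub> \<longleftrightarrow> (\<exists>u\<in>S. u \<odot>\<^bsub>M\<^esub> m = u \<odot>\<^bsub>M\<^esub> \<zero>\<^bsub>M\<^esub>)"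
    by (rule mfrac_same_denominator) (use assms in auto)
  then show ?thesis unfolding mfrac_zero[OF assms(1)] by auto
qed

text \<open>For two choices, \<open>p\<close> and \<open>q\<close> bring the resulting denominators
  to a common left multiple. After that each summand can be compared with its counterpart on its own
  by \<open>mfrac_transfer\<close>.\<close>

lemma mloc_add_mfrac:
  assumes [simp]: "s \<in> S" "m \<in> carrier M" "t \<in> S" "n \<in> carrier M" "c \<in> carrier R" "d \<in> carrier R"
    and cs: "c \<otimes> s \<in> S" and csdt: "c \<otimes> s = d \<otimes> t"
  shows "mloc_add R S M (mfrac R S M s m) (mfrac R S M t n)
    = mfrac R S M (c \<otimes> s) (c \<odot>\<^bsub>M\<^esub> m \<oplus>\<^bsub>M\<^esub> d \<odot>\<^bsub>M\<^esub> n)"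
proof -
  note [simp] = smult_closed
  have indep: "mfrac R S M (c' \<otimes> s') (c' \<odot>\<^bsub>M\<^esub> m' \<oplus>\<^bsub>M\<^esub> d' \<odot>\<^bsub>M\<^esub> n')
      = mfrac R S M (c \<otimes> s) (c \<odot>\<^bsub>M\<^esub> m \<oplus>\<^bsub>M\<^esub> d \<odot>\<^bsub>M\<^esub> n)"
    if X: "(s', m') \<in> mfrac R S M s m" and Y: "(t', n') \<in> mfrac R S M t n"
      and [simp]: "c' \<in> carrier R" "d' \<in> carrier R"
      and c': "c' \<otimes> s' \<in> S" "c' \<otimes> s' = d' \<otimes> t'" for s' m' t' n' c' d'
  proof -
    have [simp]: "s' \<in> S" "m' \<in> carrier M" "t' \<in> S" "n' \<in> carrier M"
      using mem_mfracD[OF X] mem_mfracD[OF Y] by simp_all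
    obtain p q where [simp]: "p \<in> carrier R" "q \<in> carrier R"
      and pq: "p \<otimes> (c \<otimes> s) \<in> S" "p \<otimes> (c \<otimes> s) = q \<otimes> (c' \<otimes> s')"
      using common_left_multiple[OF cs c'(1)] by metis
    have "(p \<otimes> c) \<otimes> s = (q \<otimes> c') \<otimes> s'" "(p \<otimes> d) \<otimes> t = (q \<otimes> d') \<otimes> t'"
      using pq(2) csdt c' by (simp_all add: m_assoc)
    note eqs = this
    obtain z1 where [simp]: "z1 \<in> S"
      and z1: "(z1 \<otimes> (p \<otimes> c)) \<odot>\<^bsub>M\<^esub> m = (z1 \<otimes> (q \<otimes> c')) \<odot>\<^bsub>M\<^esub> m'"
      by (rule mfrac_transfer[OF X _ _ _ _ eqs(1)]) auto
    obtain z2 where [simp]: "z2 \<in> S"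
      and z2: "(z2 \<otimes> (p \<otimes> d)) \<odot>\<^bsub>M\<^esub> n = (z2 \<otimes> (q \<otimes> d')) \<odot>\<^bsub>M\<^esub> n'"
      by (rule mfrac_transfer[OF Y _ _ _ _ eqs(2)]) auto
    \<comment> \<open>The two summands were matched with different multipliers; \<open>w\<close>, a
      common left multiple of \<open>z1\<close> and \<open>z2\<close>, matches both at once.\<close>
    obtain g h where [simp]: "g \<in> carrier R" "h \<in> carrier R"
      and gh: "g \<otimes> z1 \<in> S" "g \<otimes> z1 = h \<otimes> z2"
      using common_left_multiple[of z1 z2] by (metis \<open>z1 \<in> S\<close> \<open>z2 \<in> S\<close>)
    define w where "w = g \<otimes> z1"
    have [simp]: "w \<in> S" using gh w_def by simp
    have w1: "(w \<otimes> (p \<otimes> c)) \<odot>\<^bsub>M\<^esub> m = (w \<otimes> (q \<otimes> c')) \<odot>\<^bsub>M\<^esub> m'"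
      using arg_cong[OF z1, of "\<lambda>x. g \<odot>\<^bsub>M\<^esub> x"] unfolding w_def
      by (simp add: smult_assoc[symmetric] m_assoc)
    have w2: "(w \<otimes> (p \<otimes> d)) \<odot>\<^bsub>M\<^esub> n = (w \<otimes> (q \<otimes> d')) \<odot>\<^bsub>M\<^esub> n'"
      using arg_cong[OF z2, of "\<lambda>x. h \<odot>\<^bsub>M\<^esub> x"] unfolding w_def gh(2)
      by (simp add: smult_assoc[symmetric] m_assoc)
    have "(c' \<otimes> s', c' \<odot>\<^bsub>M\<^esub> m' \<oplus>\<^bsub>M\<^esub> d' \<odot>\<^bsub>M\<^esub> n')
        \<in> mfrac R S M (c \<otimes> s) (c \<odot>\<^bsub>M\<^esub> m \<oplus>\<^bsub>M\<^esub> d \<odot>\<^bsub>M\<^esub> n)"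
    proof (rule mfracI[of "w \<otimes> p" _ "w \<otimes> q"])
      have "(w \<otimes> p) \<otimes> (c \<otimes> s) = w \<otimes> (p \<otimes> (c \<otimes> s))" by (simp add: m_assoc)
      then show "(w \<otimes> p) \<otimes> (c \<otimes> s) \<in> S" using pq by (metis S_mult \<open>w \<in> S\<close>)
      show "(w \<otimes> p) \<otimes> (c \<otimes> s) = (w \<otimes> q) \<otimes> (c' \<otimes> s')" using pq by (simp add: m_assoc)
      show "(w \<otimes> p) \<odot>\<^bsub>M\<^esub> (c \<odot>\<^bsub>M\<^esub> m \<oplus>\<^bsub>M\<^esub> d \<odot>\<^bsub>M\<^esub> n)
          = (w \<otimes> q) \<odot>\<^bsub>M\<^esub> (c' \<odot>\<^bsub>M\<^esub> m' \<oplus>\<^bsub>M\<^esub> d' \<odot>\<^bsub>M\<^esub> n')"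
        using w1 w2 by (simp add: smult_r_distr smult_assoc[symmetric] m_assoc)
    qed (use c' in auto)
    moreover have "d' \<otimes> t' \<in> S" using c' by simp
    ultimately show ?thesis using cs c'(1) by (subst eq_commute, subst mfrac_eq_iff) auto
  qed
  show ?thesis unfolding mloc_add_def
  proof (rule Union_eq_witness, goal_cases)
    case 1
    show ?case
      by (intro CollectI exI conjI, rule refl) (use mfrac_self cs csdt in auto)
  next
    case (2 B)
    then show ?case
      by (elim CollectE exE conjE) (hypsubst, rule indep; assumption)
  qed
qed

corollary mloc_add_same_denominator:
  assumes "s \<in> S" "m \<in> carrier M" "n \<in> carrier M"
  shows "mloc_add R S M (mfrac R S M s m) (mfrac R S M s n) = mfrac R S M s (m \<oplus>\<^bsub>M\<^esub> n)"
  using mloc_add_mfrac[of s m s n \<one> \<one>] assms by (simp add: smult_one)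

end

context left_den
begin

text \<open>\<open>frac\<close> is \<open>mfrac\<close> for the regular module, so all facts about
  module fractions hold for ring fractions under the prefix \<open>reg\<close>; the rewrites state
  them in terms of \<open>R\<close>.\<close>

sublocale reg: left_den_module R S "regular_module R"
  rewrites "carrier (regular_module R) = carrier R"
    and "zero (regular_module R) = \<zero>"
    and "add (regular_module R) = add R"
    and "smult (regular_module R) = mult R"
  using left_module_regular
  by (simp_all add: left_den_module_def left_den_axioms)

end

lemma left_loc_module_simps [simp]:
  "carrier (left_loc_module R S M) = {mfrac R S M s m | s m. s \<in> S \<and> m \<in> carrier M}"
  "zero (left_loc_module R S M) = mfrac R S M \<one>\<^bsub>R\<^esub> \<zero>\<^bsub>M\<^esub>"
  "add (left_loc_module R S M) = mloc_add R S M"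
  "smult (left_loc_module R S M) = mloc_smult R S M"
  by (simp_all add: left_loc_module_def)

lemma left_loc_simps [simp]:
  "carrier (left_loc R S) = {frac R S s r | s r. s \<in> S \<and> r \<in> carrier R}"
  "zero (left_loc R S) = frac R S \<one>\<^bsub>R\<^esub> \<zero>\<^bsub>R\<^esub>"
  "one (left_loc R S) = frac R S \<one>\<^bsub>R\<^esub> \<one>\<^bsub>R\<^esub>"
  "add (left_loc R S) = mloc_add R S (regular_module R)"
  "mult (left_loc R S) = mloc_smult R S (regular_module R)"
  by (simp_all add: left_loc_def)

section \<open>The action of the ring of fractions on a module of fractions\<close>

context left_den_module
begin

text \<open>Both arguments vary at once. The first relation is transferred in the regular module and
  gives an equation between multiples of \<open>a\<close> and \<open>a'\<close>; by
  \<open>u \<otimes> a = c \<otimes> t\<close> it becomes one between multiples of \<open>t\<close>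
  and \<open>t'\<close>. Their common value need not be in \<open>S\<close>, which is exactly the
  case that \<open>mfrac_transfer\<close> admits.\<close>

lemma mloc_smult_mfrac:
  assumes [simp]: "s \<in> S" "a \<in> carrier R" "t \<in> S" "n \<in> carrier M" "u \<in> S" "c \<in> carrier R"
    and uact: "u \<otimes> a = c \<otimes> t"
  shows "mloc_smult R S M (frac R S s a) (mfrac R S M t n) = mfrac R S M (u \<otimes> s) (c \<odot>\<^bsub>M\<^esub> n)"
proof -
  note [simp] = smult_closed
  have indep: "mfrac R S M (u' \<otimes> s') (c' \<odot>\<^bsub>M\<^esub> n') = mfrac R S M (u \<otimes> s) (c \<odot>\<^bsub>M\<^esub> n)"
    if X: "(s', a') \<in> frac R S s a" and Y: "(t', n') \<in> mfrac R S M t n"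
      and [simp]: "u' \<in> S" "c' \<in> carrier R" and c': "u' \<otimes> a' = c' \<otimes> t'" for s' a' t' n' u' c'
  proof -
    have [simp]: "s' \<in> S" "a' \<in> carrier R" "t' \<in> S" "n' \<in> carrier M"
      using reg.mem_mfracD[OF X] mem_mfracD[OF Y] by simp_all
    obtain p q where [simp]: "p \<in> carrier R" "q \<in> carrier R"
      and pq: "p \<otimes> (u \<otimes> s) \<in> S" "p \<otimes> (u \<otimes> s) = q \<otimes> (u' \<otimes> s')"
      using common_left_multiple[of "u \<otimes> s" "u' \<otimes> s'"] by (metis S_mult \<open>s' \<in> S\<close> \<open>u' \<in> S\<close> assms(1,5))
    have s_eq: "(p \<otimes> u) \<otimes> s = (q \<otimes> u') \<otimes> s'"
      using pq(2) by (simp add: m_assoc)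
    obtain z where [simp]: "z \<in> S" and z: "(z \<otimes> (p \<otimes> u)) \<otimes> a = (z \<otimes> (q \<otimes> u')) \<otimes> a'"
      by (rule reg.mfrac_transfer[OF X _ _ _ _ s_eq]) auto
    have t_eq: "(z \<otimes> p \<otimes> c) \<otimes> t = (z \<otimes> q \<otimes> c') \<otimes> t'"
      using z by (simp add: m_assoc uact c')
    obtain w where [simp]: "w \<in> S"
      and w: "(w \<otimes> (z \<otimes> p \<otimes> c)) \<odot>\<^bsub>M\<^esub> n = (w \<otimes> (z \<otimes> q \<otimes> c')) \<odot>\<^bsub>M\<^esub> n'"
      by (rule mfrac_transfer[OF Y _ _ _ _ t_eq]) auto
    have "(u' \<otimes> s', c' \<odot>\<^bsub>M\<^esub> n') \<in> mfrac R S M (u \<otimes> s) (c \<odot>\<^bsub>M\<^esub> n)"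
    proof (rule mfracI[of "w \<otimes> z \<otimes> p" _ "w \<otimes> z \<otimes> q"])
      have "(w \<otimes> z \<otimes> p) \<otimes> (u \<otimes> s) = (w \<otimes> z) \<otimes> (p \<otimes> (u \<otimes> s))" by (simp add: m_assoc)
      then show "(w \<otimes> z \<otimes> p) \<otimes> (u \<otimes> s) \<in> S"
        using S_mult[OF S_mult[OF \<open>w \<in> S\<close> \<open>z \<in> S\<close>] pq(1)] by simp
      show "(w \<otimes> z \<otimes> p) \<otimes> (u \<otimes> s) = (w \<otimes> z \<otimes> q) \<otimes> (u' \<otimes> s')"
        using pq by (simp add: m_assoc)
      show "(w \<otimes> z \<otimes> p) \<odot>\<^bsub>M\<^esub> (c \<odot>\<^bsub>M\<^esub> n) = (w \<otimes> z \<otimes> q) \<odot>\<^bsub>M\<^esub> (c' \<odot>\<^bsub>M\<^esub> n')"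
        using w by (simp add: smult_assoc[symmetric] m_assoc)
    qed auto
    then show ?thesis by (subst eq_commute, subst mfrac_eq_iff) auto
  qed
  show ?thesis unfolding mloc_smult_def
  proof (rule Union_eq_witness, goal_cases)
    case 1
    show ?case
      by (intro CollectI exI conjI, rule refl) (use mfrac_self reg.mfrac_self uact in auto)
  next
    case (2 B)
    then show ?case
      by (elim CollectE exE conjE) (hypsubst, rule indep; assumption)
  qed
qed

text \<open>Over one denominator, addition is addition of numerators, so the additive laws of the
  localization reduce to those of \<open>M\<close>.\<close>

lemma common_denominator:
  assumes "X \<in> carrier (left_loc_module R S M)" "Y \<in> carrier (left_loc_module R S M)"
  obtains s m n where "s \<in> S" "m \<in> carrier M" "n \<in> carrier M"
    "X = mfrac R S M s m" "Y = mfrac R S M s n"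
proof -
  obtain s m t n where st: "s \<in> S" "m \<in> carrier M" "t \<in> S" "n \<in> carrier M"
    and XY: "X = mfrac R S M s m" "Y = mfrac R S M t n"
    using assms by auto
  obtain c d where cd: "c \<in> carrier R" "d \<in> carrier R" "c \<otimes> s \<in> S" "c \<otimes> s = d \<otimes> t"
    using common_left_multiple[OF st(1,3)] by metis
  show thesis
  proof (rule that)
    show "X = mfrac R S M (c \<otimes> s) (c \<odot>\<^bsub>M\<^esub> m)" "Y = mfrac R S M (c \<otimes> s) (d \<odot>\<^bsub>M\<^esub> n)"
      using XY st cd mfrac_scale[of c s m] mfrac_scale[of d t n] by auto
  qed (use st cd smult_closed in auto)
qed

lemma common_denominator3:
  assumes "X \<in> carrier (left_loc_module R S M)" "Y \<in> carrier (left_loc_module R S M)"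
    "Z \<in> carrier (left_loc_module R S M)"
  obtains s m n p where "s \<in> S" "m \<in> carrier M" "n \<in> carrier M" "p \<in> carrier M"
    "X = mfrac R S M s m" "Y = mfrac R S M s n" "Z = mfrac R S M s p"
proof -
  obtain s m n where st: "s \<in> S" "m \<in> carrier M" "n \<in> carrier M"
    and XY: "X = mfrac R S M s m" "Y = mfrac R S M s n"
    using common_denominator[OF assms(1,2)] .
  obtain t p where tp: "t \<in> S" "p \<in> carrier M" "Z = mfrac R S M t p"
    using assms(3) by auto
  obtain c d where cd: "c \<in> carrier R" "d \<in> carrier R" "c \<otimes> s \<in> S" "c \<otimes> s = d \<otimes> t"
    using common_left_multiple[OF st(1) tp(1)] by metis
  show thesis
  proof (rule that)
    show "X = mfrac R S M (c \<otimes> s) (c \<odot>\<^bsub>M\<^esub> m)" "Y = mfrac R S M (c \<otimes> s) (c \<odot>\<^bsub>M\<^esub> n)"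
      "Z = mfrac R S M (c \<otimes> s) (d \<odot>\<^bsub>M\<^esub> p)"
      using XY st cd tp mfrac_scale[of c s m] mfrac_scale[of c s n] mfrac_scale[of d t p] by auto
  qed (use st cd tp smult_closed in auto)
qed

lemma mfrac_carrier: "s \<in> S \<Longrightarrow> m \<in> carrier M \<Longrightarrow> mfrac R S M s m \<in> carrier (left_loc_module R S M)"
  by auto

lemma abelian_group_loc: "abelian_group (left_loc_module R S M)"
proof (rule abelian_groupI)
  fix X Y assume "X \<in> carrier (left_loc_module R S M)" "Y \<in> carrier (left_loc_module R S M)"
  then obtain s m n where smn: "s \<in> S" "m \<in> carrier M" "n \<in> carrier M"
    and XY: "X = mfrac R S M s m" "Y = mfrac R S M s n"
    by (rule common_denominator)
  show "X \<oplus>\<^bsub>left_loc_module R S M\<^esub> Y \<in> carrier (left_loc_module R S M)"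
    using mfrac_carrier[of s "m \<oplus>\<^bsub>M\<^esub> n"] smn unfolding XY
    by (simp add: mloc_add_same_denominator del: left_loc_module_simps(1))
  show "X \<oplus>\<^bsub>left_loc_module R S M\<^esub> Y = Y \<oplus>\<^bsub>left_loc_module R S M\<^esub> X"
    using smn unfolding XY by (simp add: mloc_add_same_denominator M.a_comm)
next
  fix X Y Z assume "X \<in> carrier (left_loc_module R S M)" "Y \<in> carrier (left_loc_module R S M)"
    "Z \<in> carrier (left_loc_module R S M)"
  then obtain s m n p where smn: "s \<in> S" "m \<in> carrier M" "n \<in> carrier M" "p \<in> carrier M"
    and XY: "X = mfrac R S M s m" "Y = mfrac R S M s n" "Z = mfrac R S M s p"
    by (rule common_denominator3)
  show "X \<oplus>\<^bsub>left_loc_module R S M\<^esub> Y \<oplus>\<^bsub>left_loc_module R S M\<^esub> Z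
    = X \<oplus>\<^bsub>left_loc_module R S M\<^esub> (Y \<oplus>\<^bsub>left_loc_module R S M\<^esub> Z)"
    using smn unfolding XY by (simp add: mloc_add_same_denominator M.a_assoc)
next
  fix X assume "X \<in> carrier (left_loc_module R S M)"
  then obtain s m where sm: "s \<in> S" "m \<in> carrier M" and X: "X = mfrac R S M s m"
    by auto
  show "\<zero>\<^bsub>left_loc_module R S M\<^esub> \<oplus>\<^bsub>left_loc_module R S M\<^esub> X = X"
    using sm unfolding X
    by (simp add: mfrac_zero[of s, symmetric] mloc_add_same_denominator)
  have "mfrac R S M s (\<ominus>\<^bsub>M\<^esub> m) \<oplus>\<^bsub>left_loc_module R S M\<^esub> X = \<zero>\<^bsub>left_loc_module R S M\<^esub>"
    using sm unfolding X
    by (simp add: mfrac_zero[of s] mloc_add_same_denominator M.l_neg)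
  then show "\<exists>Y\<in>carrier (left_loc_module R S M).
      Y \<oplus>\<^bsub>left_loc_module R S M\<^esub> X = \<zero>\<^bsub>left_loc_module R S M\<^esub>"
    using mfrac_carrier sm M.a_inv_closed by blast
qed (rule mfrac_carrier[of \<one> "\<zero>\<^bsub>M\<^esub>", simplified left_loc_module_simps(2)[symmetric]]; simp)

end

context left_den_module
begin

lemma mloc_smult_closed:
  assumes "X \<in> carrier (left_loc R S)" "Y \<in> carrier (left_loc_module R S M)"
  shows "mloc_smult R S M X Y \<in> carrier (left_loc_module R S M)"
proof -
  obtain s a t n where 1: "s \<in> S" "a \<in> carrier R" "t \<in> S" "n \<in> carrier M"
    and XY: "X = frac R S s a" "Y = mfrac R S M t n"
    using assms by auto
  obtain u c where "u \<in> S" "c \<in> carrier R" "u \<otimes> a = c \<otimes> t"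
    using Ore[OF 1(2,3)] .
  then show ?thesis
    unfolding XY using 1 mfrac_carrier[of "u \<otimes> s" "c \<odot>\<^bsub>M\<^esub> n"]
    by (simp add: mloc_smult_mfrac smult_closed del: left_loc_module_simps(1))
qed

lemma mloc_smult_r_distr:
  assumes "X \<in> carrier (left_loc R S)"
    "Y \<in> carrier (left_loc_module R S M)" "Z \<in> carrier (left_loc_module R S M)"
  shows "mloc_smult R S M X (mloc_add R S M Y Z)
    = mloc_add R S M (mloc_smult R S M X Y) (mloc_smult R S M X Z)"
proof -
  obtain s a where 1: "s \<in> S" "a \<in> carrier R" "X = frac R S s a"
    using assms by auto
  obtain t n p where 2: "t \<in> S" "n \<in> carrier M" "p \<in> carrier M"
    "Y = mfrac R S M t n" "Z = mfrac R S M t p"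
    using common_denominator[OF assms(2,3)] .
  obtain u c where "u \<in> S" "c \<in> carrier R" "u \<otimes> a = c \<otimes> t"
    using Ore[OF 1(2) 2(1)] .
  then show ?thesis
    using 1 2
    by (simp add: mloc_smult_mfrac mloc_add_same_denominator smult_closed smult_r_distr)
qed

lemma mloc_smult_l_distr:
  assumes "X \<in> carrier (left_loc R S)" "Y \<in> carrier (left_loc R S)"
    "Z \<in> carrier (left_loc_module R S M)"
  shows "mloc_smult R S M (mloc_add R S (regular_module R) X Y) Z
    = mloc_add R S M (mloc_smult R S M X Z) (mloc_smult R S M Y Z)"
proof -
  have "X \<in> carrier (left_loc_module R S (regular_module R))"
    "Y \<in> carrier (left_loc_module R S (regular_module R))"
    using assms by auto
  then obtain s a b where 1: "s \<in> S" "a \<in> carrier R" "b \<in> carrier R"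
    "X = frac R S s a" "Y = frac R S s b"
    by (rule reg.common_denominator)
  obtain t n where 2: "t \<in> S" "n \<in> carrier M" "Z = mfrac R S M t n"
    using assms by auto
  obtain u c where u: "u \<in> S" "c \<in> carrier R" "u \<otimes> a = c \<otimes> t"
    using Ore[OF 1(2) 2(1)] .
  obtain v d where v: "v \<in> S" "d \<in> carrier R" "v \<otimes> b = d \<otimes> t"
    using Ore[OF 1(3) 2(1)] .
  \<comment> \<open>The Ore multipliers \<open>u\<close> for \<open>a\<close> and \<open>v\<close>
    for \<open>b\<close> are replaced by a common left multiple \<open>w\<close>, so that both
    products and the product with the sum get the denominator \<open>w \<otimes> s\<close>.\<close>
  obtain x y where x: "x \<in> carrier R" "y \<in> carrier R" "x \<otimes> u \<in> S" "x \<otimes> u = y \<otimes> v"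
    using common_left_multiple[OF u(1) v(1)] by metis
  define w where "w = x \<otimes> u"
  have w: "w \<in> S" using x w_def by simp
  have wa: "w \<otimes> a = (x \<otimes> c) \<otimes> t"
    unfolding w_def using x(1,2) u 1 2 by (simp add: m_assoc)
  have wb: "w \<otimes> b = (y \<otimes> d) \<otimes> t"
    unfolding w_def x(4) using x v 1 2 by (simp add: m_assoc)
  have wab: "w \<otimes> (a \<oplus> b) = (x \<otimes> c \<oplus> y \<otimes> d) \<otimes> t"
    using w wa wb x u v 1 2 by (simp add: r_distr l_distr)
  have "mloc_smult R S M X Z = mfrac R S M (w \<otimes> s) ((x \<otimes> c) \<odot>\<^bsub>M\<^esub> n)"
    "mloc_smult R S M Y Z = mfrac R S M (w \<otimes> s) ((y \<otimes> d) \<odot>\<^bsub>M\<^esub> n)"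
    "mloc_smult R S M (mloc_add R S (regular_module R) X Y) Z
      = mfrac R S M (w \<otimes> s) ((x \<otimes> c \<oplus> y \<otimes> d) \<odot>\<^bsub>M\<^esub> n)"
    using 1 2 x(1,2) u(2) v(2) w wa wb wab mloc_smult_mfrac[of s a t n w "x \<otimes> c"]
      mloc_smult_mfrac[of s b t n w "y \<otimes> d"]
      mloc_smult_mfrac[of s "a \<oplus> b" t n w "x \<otimes> c \<oplus> y \<otimes> d"]
    by (simp_all add: reg.mloc_add_same_denominator)
  then show ?thesis
    using 1 2 x u v w
    by (simp add: mloc_add_same_denominator smult_closed smult_l_distr)
qed

text \<open>The Ore multipliers are chosen for the right bracketing and also serve the left one:
  \<open>u \<otimes> a = (c \<otimes> u') \<otimes> t\<close> computes \<open>X Y\<close>, whose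
  numerator \<open>c \<otimes> u' \<otimes> b\<close> equals
  \<open>c \<otimes> c' \<otimes> v\<close>, so that multiplying by \<open>Z\<close> takes the
  multiplier \<open>\<one>\<close>.\<close>

lemma mloc_smult_assoc:
  assumes "X \<in> carrier (left_loc R S)" "Y \<in> carrier (left_loc R S)"
    "Z \<in> carrier (left_loc_module R S M)"
  shows "mloc_smult R S M (mloc_smult R S (regular_module R) X Y) Z
    = mloc_smult R S M X (mloc_smult R S M Y Z)"
proof -
  obtain s a t b v n where [simp]: "s \<in> S" "a \<in> carrier R" "t \<in> S" "b \<in> carrier R" "v \<in> S" "n \<in> carrier M"
    and XYZ: "X = frac R S s a" "Y = frac R S t b" "Z = mfrac R S M v n"
    using assms by auto
  obtain u' c' where [simp]: "u' \<in> S" "c' \<in> carrier R" and u': "u' \<otimes> b = c' \<otimes> v"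
    using Ore[of b v] by auto
  obtain u c where [simp]: "u \<in> S" "c \<in> carrier R" and u: "u \<otimes> a = c \<otimes> (u' \<otimes> t)"
    using Ore[of a "u' \<otimes> t"] by auto
  have YZ: "mloc_smult R S M Y Z = mfrac R S M (u' \<otimes> t) (c' \<odot>\<^bsub>M\<^esub> n)"
    unfolding XYZ using u' by (simp add: mloc_smult_mfrac)
  have XYZ1: "mloc_smult R S M X (mloc_smult R S M Y Z) = mfrac R S M (u \<otimes> s) (c \<odot>\<^bsub>M\<^esub> (c' \<odot>\<^bsub>M\<^esub> n))"
    unfolding YZ using u by (simp add: XYZ(1) mloc_smult_mfrac smult_closed)
  have XY: "mloc_smult R S (regular_module R) X Y = frac R S (u \<otimes> s) (c \<otimes> u' \<otimes> b)"
    unfolding XYZ using u by (subst reg.mloc_smult_mfrac[of _ _ _ _ u "c \<otimes> u'"]) (simp_all add: m_assoc)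
  have "mloc_smult R S M (mloc_smult R S (regular_module R) X Y) Z
      = mfrac R S M (\<one> \<otimes> (u \<otimes> s)) ((c \<otimes> c') \<odot>\<^bsub>M\<^esub> n)"
    unfolding XY XYZ(3) using u' by (intro mloc_smult_mfrac) (simp_all add: m_assoc)
  then show ?thesis unfolding XYZ1 by (simp add: smult_assoc)
qed

lemma mloc_smult_one:
  assumes "X \<in> carrier (left_loc_module R S M)"
  shows "mloc_smult R S M (frac R S \<one> \<one>) X = X"
proof -
  obtain t n where X: "t \<in> S" "n \<in> carrier M" "X = mfrac R S M t n"
    using assms by auto
  then show ?thesis
    using mloc_smult_mfrac[of \<one> \<one> t n t \<one>] by (simp add: smult_one)
qed

end

section \<open>The ring of fractions\<close>

context left_den
begin

text \<open>The ring laws are module laws for the regular module; the right unit law has no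
  counterpart there and is computed directly.\<close>

lemma ring_left_loc: "ring (left_loc R S)"
proof -
  let ?L = "left_loc_module R S (regular_module R)"
  interpret L: abelian_group ?L by (rule reg.abelian_group_loc)
  have carr [simp]: "carrier ?L = carrier (left_loc R S)" by simp
  have "abelian_group (left_loc R S)"
  proof (rule abelian_groupI)
    fix x assume "x \<in> carrier (left_loc R S)"
    then have "\<ominus>\<^bsub>?L\<^esub> x \<in> carrier (left_loc R S)" "\<ominus>\<^bsub>?L\<^esub> x \<oplus>\<^bsub>?L\<^esub> x = \<zero>\<^bsub>?L\<^esub>"
      using L.a_inv_closed L.l_neg unfolding carr by blast+
    then show "\<exists>y\<in>carrier (left_loc R S). y \<oplus>\<^bsub>left_loc R S\<^esub> x = \<zero>\<^bsub>left_loc R S\<^esub>"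
      by (intro bexI[of _ "\<ominus>\<^bsub>?L\<^esub> x"]) simp_all
  qed (use L.a_closed L.zero_closed L.a_assoc L.a_comm L.l_zero in \<open>simp_all del: left_loc_simps(1) left_loc_module_simps(1)\<close>)
  moreover have "monoid (left_loc R S)"
  proof (rule monoidI)
    fix x y z assume x: "x \<in> carrier (left_loc R S)" and y: "y \<in> carrier (left_loc R S)"
      and z: "z \<in> carrier (left_loc R S)"
    show "x \<otimes>\<^bsub>left_loc R S\<^esub> y \<in> carrier (left_loc R S)"
      using reg.mloc_smult_closed[of x y] x y by (simp del: left_loc_simps(1) left_loc_module_simps(1))
    show "x \<otimes>\<^bsub>left_loc R S\<^esub> y \<otimes>\<^bsub>left_loc R S\<^esub> z = x \<otimes>\<^bsub>left_loc R S\<^esub> (y \<otimes>\<^bsub>left_loc R S\<^esub> z)"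
      using reg.mloc_smult_assoc[of x y z] x y z by (simp del: left_loc_simps(1) left_loc_module_simps(1))
  next
    show "\<one>\<^bsub>left_loc R S\<^esub> \<in> carrier (left_loc R S)" by auto
  next
    fix x assume x: "x \<in> carrier (left_loc R S)"
    show "\<one>\<^bsub>left_loc R S\<^esub> \<otimes>\<^bsub>left_loc R S\<^esub> x = x"
      using reg.mloc_smult_one[of x] x by (simp del: left_loc_simps(1) left_loc_module_simps(1))
    obtain s a where "s \<in> S" "a \<in> carrier R" "x = frac R S s a"
      using x by auto
    then show "x \<otimes>\<^bsub>left_loc R S\<^esub> \<one>\<^bsub>left_loc R S\<^esub> = x"
      using reg.mloc_smult_mfrac[of s a \<one> \<one> \<one> a] by simp
  qed
  ultimately show ?thesis
    by (rule ringI)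
      (use reg.mloc_smult_l_distr reg.mloc_smult_r_distr
        in \<open>simp_all del: left_loc_simps(1) left_loc_module_simps(1)\<close>)
qed

end

lemma (in left_den_module) left_module_loc: "left_module (left_loc R S) (left_loc_module R S M)"
  unfolding left_module_def left_module_axioms_def
  using ring_left_loc abelian_group_loc mloc_smult_closed mloc_smult_l_distr mloc_smult_r_distr
    mloc_smult_assoc mloc_smult_one
  by (simp del: left_loc_simps(1) left_loc_module_simps(1))

section \<open>Localization of quotients\<close>

lemma (in ring) left_module_quotient:
  assumes "ideal J R"
  shows "left_module R (quotient_module R J)"
proof -
  interpret J: ideal J R by fact
  interpret Q: ring "R Quot J" by (rule J.quotient_is_ring)
  interpret h: ring_hom_ring R "R Quot J" "(+>) J" by (rule J.rcos_ring_hom_ring)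
  have simps: "carrier (quotient_module R J) = carrier (R Quot J)"
    "zero (quotient_module R J) = zero (R Quot J)"
    "add (quotient_module R J) = add (R Quot J)"
    "smult (quotient_module R J) = (\<lambda>r X. (J +> r) \<otimes>\<^bsub>R Quot J\<^esub> X)"
    by (simp_all add: quotient_module_def)
  have "abelian_group (quotient_module R J)"
    by (rule abelian_groupI)
      (auto simp: simps Q.a_ac intro: bexI[of _ "\<ominus>\<^bsub>R Quot J\<^esub> _"] Q.l_neg)
  then show ?thesis
    unfolding left_module_def left_module_axioms_def simps
    by (auto simp: ring_axioms Q.l_distr Q.r_distr Q.m_assoc)
qed

lemma (in ideal) rcos_eq_iff:
  assumes "a \<in> carrier R" "b \<in> carrier R"
  shows "I +> a = I +> b \<longleftrightarrow> a \<ominus> b \<in> I"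
  using assms quotient_eq_iff_same_a_r_cos[OF is_ideal] by blast

lemma (in ideal) rcos_eq_zero_iff:
  assumes "a \<in> carrier R"
  shows "I +> a = \<zero>\<^bsub>R Quot I\<^esub> \<longleftrightarrow> a \<in> I"
  using rcos_eq_iff[OF assms zero_closed] assms
  by (simp add: FactRing_def a_minus_def a_coset_join2[OF _ a_subgroup])

lemma (in ideal) FactRing_carrierE:
  assumes "X \<in> carrier (R Quot I)"
  obtains x where "x \<in> carrier R" "X = I +> x"
  using assms by (auto simp: FactRing_simps)

text \<open>The first isomorphism theorem for \<open>A\<close> as a left module over itself.
  \<open>K\<close> is taken two-sided because \<open>quotient_module\<close> is built on the factor
  ring.\<close>

lemma left_module_first_iso:
  assumes "left_module A M" and K: "ideal K A"
    and h: "h \<in> carrier A \<rightarrow> carrier M" "h ` carrier A = carrier M"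
    and add: "\<And>x y. \<lbrakk>x \<in> carrier A; y \<in> carrier A\<rbrakk> \<Longrightarrow> h (x \<oplus>\<^bsub>A\<^esub> y) = h x \<oplus>\<^bsub>M\<^esub> h y"
    and lin: "\<And>a x. \<lbrakk>a \<in> carrier A; x \<in> carrier A\<rbrakk> \<Longrightarrow> h (a \<otimes>\<^bsub>A\<^esub> x) = a \<odot>\<^bsub>M\<^esub> h x"
    and ker: "\<And>x. x \<in> carrier A \<Longrightarrow> h x = \<zero>\<^bsub>M\<^esub> \<longleftrightarrow> x \<in> K"
  shows "\<exists>g \<in> left_module_iso A (quotient_module A K) M. \<forall>x\<in>carrier A. g (K +>\<^bsub>A\<^esub> x) = h x"
proof -
  interpret K: ideal K A by fact
  interpret M: left_module A M by fact
  interpret q: ring_hom_ring A "A Quot K" "(+>\<^bsub>A\<^esub>) K" by (rule K.rcos_ring_hom_ring)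
  have h_closed [simp]: "h x \<in> carrier M" if "x \<in> carrier A" for x
    using h(1) that by blast
  have eq_iff: "h x = h y \<longleftrightarrow> K +>\<^bsub>A\<^esub> x = K +>\<^bsub>A\<^esub> y" if xy: "x \<in> carrier A" "y \<in> carrier A" for x y
  proof -
    have "h (x \<ominus>\<^bsub>A\<^esub> y) \<oplus>\<^bsub>M\<^esub> h y = h x"
      using xy by (simp add: add[symmetric] a_minus_def K.a_assoc K.l_neg)
    then have "h x = h y \<longleftrightarrow> h (x \<ominus>\<^bsub>A\<^esub> y) = \<zero>\<^bsub>M\<^esub>"
      using xy by (metis M.M.add.r_cancel_one' M.M.l_zero h_closed K.minus_closed)
    then show ?thesis using ker xy K.rcos_eq_iff by simp
  qed
  \<comment> \<open>Any representative will do: by \<open>eq_iff\<close>, \<open>h\<close> is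
    constant on the cosets of \<open>K\<close> and separates them, and the latter gives
    injectivity.\<close>
  define g where "g X = h (SOME x. x \<in> carrier A \<and> X = K +>\<^bsub>A\<^esub> x)" for X
  have g: "g (K +>\<^bsub>A\<^esub> x) = h x" if "x \<in> carrier A" for x
    unfolding g_def using someI[of "\<lambda>y. y \<in> carrier A \<and> K +>\<^bsub>A\<^esub> x = K +>\<^bsub>A\<^esub> y" x] that eq_iff by blast
  have simps: "carrier (quotient_module A K) = carrier (A Quot K)"
    "add (quotient_module A K) = add (A Quot K)"
    "smult (quotient_module A K) = (\<lambda>r X. (K +>\<^bsub>A\<^esub> r) \<otimes>\<^bsub>A Quot K\<^esub> X)"
    by (simp_all add: quotient_module_def)
  have "g \<in> left_module_iso A (quotient_module A K) M"
    unfolding left_module_iso_def mem_Collect_eq simps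
  proof (intro conjI ballI)
    show "left_module A (quotient_module A K)" by (rule K.left_module_quotient[OF K])
    show "left_module A M" by fact
    show "bij_betw g (carrier (A Quot K)) (carrier M)"
    proof (rule bij_betw_imageI)
      show "inj_on g (carrier (A Quot K))"
        by (rule inj_onI) (elim K.FactRing_carrierE, simp add: g eq_iff)
      show "g ` carrier (A Quot K) = carrier M"
      proof
        show "g ` carrier (A Quot K) \<subseteq> carrier M"
          by (auto elim!: K.FactRing_carrierE simp: g)
        show "carrier M \<subseteq> g ` carrier (A Quot K)"
          unfolding h(2)[symmetric] by (auto simp: g[symmetric])
      qed
    qed
  next
    fix X Y assume "X \<in> carrier (A Quot K)" "Y \<in> carrier (A Quot K)"
    then obtain x y where [simp]: "x \<in> carrier A" "y \<in> carrier A" and XY: "X = K +>\<^bsub>A\<^esub> x" "Y = K +>\<^bsub>A\<^esub> y"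
      by (metis K.FactRing_carrierE)
    show "g (X \<oplus>\<^bsub>A Quot K\<^esub> Y) = g X \<oplus>\<^bsub>M\<^esub> g Y"
      unfolding XY by (simp add: q.hom_add[symmetric] g add del: q.hom_add)
  next
    fix a Y assume [simp]: "a \<in> carrier A" and "Y \<in> carrier (A Quot K)"
    then obtain y where [simp]: "y \<in> carrier A" and Y: "Y = K +>\<^bsub>A\<^esub> y"
      by (metis K.FactRing_carrierE)
    show "g ((K +>\<^bsub>A\<^esub> a) \<otimes>\<^bsub>A Quot K\<^esub> Y) = a \<odot>\<^bsub>M\<^esub> g Y"
      unfolding Y by (simp add: q.hom_mult[symmetric] g lin del: q.hom_mult)
  qed
  with g show ?thesis by blast
qed

text \<open>The common situation of \<open>ass_l R S\<close> and of the minimal primes in the finite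
  case: elements of \<open>S\<close> can be cancelled modulo \<open>J\<close> on either
  side.\<close>

locale left_den_quotient = left_den R S + ideal J R for R (structure) and S and J +
  assumes J_proper: "\<one> \<notin> J"
    and left_regular_mod: "\<lbrakk>s \<in> S; r \<in> carrier R; s \<otimes> r \<in> J\<rbrakk> \<Longrightarrow> r \<in> J"
    and right_regular_mod: "\<lbrakk>s \<in> S; r \<in> carrier R; r \<otimes> s \<in> J\<rbrakk> \<Longrightarrow> r \<in> J"
begin

lemma left_mod_iff: "s \<in> S \<Longrightarrow> r \<in> carrier R \<Longrightarrow> s \<otimes> r \<in> J \<longleftrightarrow> r \<in> J"
  using left_regular_mod I_l_closed by blast

sublocale quot: ring_hom_ring R "R Quot J" "(+>) J"
  by (rule rcos_ring_hom_ring)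

text \<open>The Ore condition is inherited by the image. Cancellation modulo \<open>J\<close> on
  both sides makes the image consist of regular elements, which gives the denominator condition and
  the trivial annihilator together.\<close>

lemma image_Den: "(+>) J ` S \<in> Den_l (R Quot J) {\<zero>\<^bsub>R Quot J\<^esub>}"
proof -
  have "submonoid ((+>) J ` S) (R Quot J)"
  proof
    show "x \<otimes>\<^bsub>R Quot J\<^esub> y \<in> (+>) J ` S" if "x \<in> (+>) J ` S" "y \<in> (+>) J ` S" for x y
      using that by (auto simp: quot.hom_mult[symmetric] simp del: quot.hom_mult)
  qed (auto simp: quot.hom_one[symmetric] simp del: quot.hom_one)
  \<comment> \<open>An element \<open>s\<close> of \<open>S\<close> in \<open>J\<close> would give
    \<open>s \<otimes> \<one> \<in> J\<close> and hence \<open>\<one> \<in> J\<close>.\<close>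
  moreover have "\<zero>\<^bsub>R Quot J\<^esub> \<notin> (+>) J ` S"
    using rcos_eq_zero_iff J_proper left_regular_mod[of _ \<one>] by fastforce
  moreover have "((+>) J ` S #>\<^bsub>R Quot J\<^esub> X) \<inter> (carrier (R Quot J) #>\<^bsub>R Quot J\<^esub> Y) \<noteq> {}"
    if X: "X \<in> carrier (R Quot J)" and Y: "Y \<in> (+>) J ` S" for X Y
  proof -
    obtain x y where xy: "x \<in> carrier R" "X = J +> x" "y \<in> S" "Y = J +> y"
      using X Y FactRing_carrierE by blast
    obtain u c where uc: "u \<in> S" "c \<in> carrier R" "u \<otimes> x = c \<otimes> y"
      using Ore[OF xy(1,3)] .
    have "(J +> u) \<otimes>\<^bsub>R Quot J\<^esub> X = (J +> c) \<otimes>\<^bsub>R Quot J\<^esub> Y"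
      using uc xy by (simp add: quot.hom_mult[symmetric] del: quot.hom_mult)
    moreover have "(J +> u) \<otimes>\<^bsub>R Quot J\<^esub> X \<in> (+>) J ` S #>\<^bsub>R Quot J\<^esub> X"
      "(J +> c) \<otimes>\<^bsub>R Quot J\<^esub> Y \<in> carrier (R Quot J) #>\<^bsub>R Quot J\<^esub> Y"
      using uc quot.hom_closed[of c] unfolding r_coset_def by blast+
    ultimately show ?thesis by auto
  qed
  moreover have zero: "Y = \<zero>\<^bsub>R Quot J\<^esub>"
    if X: "X \<in> (+>) J ` S" and Y: "Y \<in> carrier (R Quot J)"
      and XY: "X \<otimes>\<^bsub>R Quot J\<^esub> Y = \<zero>\<^bsub>R Quot J\<^esub> \<or> Y \<otimes>\<^bsub>R Quot J\<^esub> X = \<zero>\<^bsub>R Quot J\<^esub>" for X Y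
  proof -
    obtain x where x: "x \<in> S" "X = J +> x"
      using X by blast
    obtain y where y: "y \<in> carrier R" "Y = J +> y"
      using FactRing_carrierE[OF Y] .
    note xy = x y
    then have "x \<otimes> y \<in> J \<or> y \<otimes> x \<in> J"
      using XY by (simp add: quot.hom_mult[symmetric] rcos_eq_zero_iff del: quot.hom_mult)
    then show ?thesis
      using left_regular_mod[OF x(1) y(1)] right_regular_mod[OF x(1) y(1)]
        rcos_eq_zero_iff[OF y(1)] y(2) by auto
  qed
  moreover have one: "\<one>\<^bsub>R Quot J\<^esub> \<in> (+>) J ` S"
    using quot.hom_one by (metis S_one imageI)
  moreover have "\<exists>T\<in>(+>) J ` S. T \<otimes>\<^bsub>R Quot J\<^esub> X = \<zero>\<^bsub>R Quot J\<^esub>"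
    if "X \<in> carrier (R Quot J)" "Y \<in> (+>) J ` S" "X \<otimes>\<^bsub>R Quot J\<^esub> Y = \<zero>\<^bsub>R Quot J\<^esub>" for X Y
  proof -
    have "X = \<zero>\<^bsub>R Quot J\<^esub>" using zero[of Y X] that by blast
    then show ?thesis by (intro bexI[OF _ one]) simp
  qed
  ultimately have "left_denominator_set (R Quot J) ((+>) J ` S)"
    unfolding left_denominator_set_def left_Ore_set_def multiplicative_subset_def by metis
  moreover have "ass_l (R Quot J) ((+>) J ` S) = {\<zero>\<^bsub>R Quot J\<^esub>}"
  proof
    show "ass_l (R Quot J) ((+>) J ` S) \<subseteq> {\<zero>\<^bsub>R Quot J\<^esub>}"
      using zero unfolding ass_l_def by auto
    show "{\<zero>\<^bsub>R Quot J\<^esub>} \<subseteq> ass_l (R Quot J) ((+>) J ` S)"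
      using bexI[OF _ one, of "\<lambda>s. s \<otimes>\<^bsub>R Quot J\<^esub> \<zero>\<^bsub>R Quot J\<^esub> = \<zero>\<^bsub>R Quot J\<^esub>"]
      unfolding ass_l_def by simp
  qed
  ultimately show ?thesis by (simp add: Den_l_def)
qed

sublocale Q: left_den "R Quot J" "(+>) J ` S"
  using image_Den by unfold_locales (simp add: Den_l_def)

lemma frac_hom:
  assumes "s \<in> S" "r \<in> carrier R" "(t, n) \<in> frac R S s r"
  shows "frac (R Quot J) ((+>) J ` S) (J +> t) (J +> n) = frac (R Quot J) ((+>) J ` S) (J +> s) (J +> r)"
proof -
  obtain c d where cd: "c \<otimes> s \<in> S" "c \<otimes> s = d \<otimes> t" "c \<otimes> r = d \<otimes> n"
    "t \<in> S" "n \<in> carrier R" "c \<in> carrier R" "d \<in> carrier R"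
    using reg.mfracE[OF assms(3)] .
  have "(J +> t, J +> n) \<in> frac (R Quot J) ((+>) J ` S) (J +> s) (J +> r)"
  proof (rule Q.reg.mfracI[of "J +> c" _ "J +> d"])
    show "(J +> c) \<otimes>\<^bsub>R Quot J\<^esub> (J +> s) \<in> (+>) J ` S"
      using cd assms by (simp add: quot.hom_mult[symmetric] del: quot.hom_mult)
    show "(J +> c) \<otimes>\<^bsub>R Quot J\<^esub> (J +> s) = (J +> d) \<otimes>\<^bsub>R Quot J\<^esub> (J +> t)"
      "(J +> c) \<otimes>\<^bsub>R Quot J\<^esub> (J +> r) = (J +> d) \<otimes>\<^bsub>R Quot J\<^esub> (J +> n)"
      using cd assms by (simp_all add: quot.hom_mult[symmetric] del: quot.hom_mult)
  qed (use cd in auto)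
  then show ?thesis
    using assms cd by (subst eq_commute, subst Q.reg.mfrac_eq_iff) auto
qed

lemma loc_quot_map_frac:
  assumes "s \<in> S" "r \<in> carrier R"
  shows "loc_quot_map R S J (frac R S s r) = frac (R Quot J) ((+>) J ` S) (J +> s) (J +> r)"
  unfolding loc_quot_map_def
proof (rule Union_eq_witness, goal_cases)
  case 1
  show ?case by (intro CollectI exI conjI, rule refl) (use reg.mfrac_self assms in auto)
next
  case (2 B)
  then show ?case using frac_hom[OF assms] by blast
qed

lemma loc_quot_map_hom: "ring_hom_ring (left_loc R S) (left_loc (R Quot J) ((+>) J ` S)) (loc_quot_map R S J)"
proof (rule ring_hom_ringI[OF ring_left_loc Q.ring_left_loc])
  fix x assume "x \<in> carrier (left_loc R S)"
  then show "loc_quot_map R S J x \<in> carrier (left_loc (R Quot J) ((+>) J ` S))"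
    using quot.hom_closed by (fastforce simp: loc_quot_map_frac)
next
  fix x y assume xy: "x \<in> carrier (left_loc R S)" "y \<in> carrier (left_loc R S)"
  then obtain s m n where "s \<in> S" "m \<in> carrier R" "n \<in> carrier R" "x = frac R S s m" "y = frac R S s n"
    using reg.common_denominator[of x y] by auto
  then show "loc_quot_map R S J (x \<oplus>\<^bsub>left_loc R S\<^esub> y)
    = loc_quot_map R S J x \<oplus>\<^bsub>left_loc (R Quot J) ((+>) J ` S)\<^esub> loc_quot_map R S J y"
    by (simp add: loc_quot_map_frac reg.mloc_add_same_denominator Q.reg.mloc_add_same_denominator)
  obtain s a t b where 1: "s \<in> S" "a \<in> carrier R" "t \<in> S" "b \<in> carrier R" "x = frac R S s a" "y = frac R S t b"
    using xy by auto
  obtain u c where u: "u \<in> S" "c \<in> carrier R" "u \<otimes> a = c \<otimes> t"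
    using Ore[OF 1(2,3)] .
  have "(J +> u) \<otimes>\<^bsub>R Quot J\<^esub> (J +> a) = (J +> c) \<otimes>\<^bsub>R Quot J\<^esub> (J +> t)"
    using u 1 by (simp add: quot.hom_mult[symmetric] del: quot.hom_mult)
  then show "loc_quot_map R S J (x \<otimes>\<^bsub>left_loc R S\<^esub> y)
    = loc_quot_map R S J x \<otimes>\<^bsub>left_loc (R Quot J) ((+>) J ` S)\<^esub> loc_quot_map R S J y"
    using u 1 reg.mloc_smult_mfrac[of s a t b u c]
      Q.reg.mloc_smult_mfrac[of "J +> s" "J +> a" "J +> t" "J +> b" "J +> u" "J +> c"]
    by (simp add: loc_quot_map_frac)
qed (simp add: loc_quot_map_frac)

lemma loc_quot_map_surj: "loc_quot_map R S J ` carrier (left_loc R S) = carrier (left_loc (R Quot J) ((+>) J ` S))"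
proof
  show "carrier (left_loc (R Quot J) ((+>) J ` S)) \<subseteq> loc_quot_map R S J ` carrier (left_loc R S)"
    by (auto elim!: FactRing_carrierE simp flip: loc_quot_map_frac intro!: imageI) blast
qed (use ring_hom_ring.homh[OF loc_quot_map_hom] in \<open>auto dest: ring_hom_closed simp del: left_loc_simps(1)\<close>)

lemma loc_quot_map_eq_zero_iff:
  assumes "s \<in> S" "r \<in> carrier R"
  shows "loc_quot_map R S J (frac R S s r) = \<zero>\<^bsub>left_loc (R Quot J) ((+>) J ` S)\<^esub> \<longleftrightarrow> r \<in> J"
  using assms
  by (simp add: loc_quot_map_frac Q.reg.mfrac_eq_zero_iff bex_simps left_mod_iff
      quot.hom_mult[symmetric] rcos_eq_zero_iff del: quot.hom_mult) (use S_one in blast)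

text \<open>This is how the fractions with numerator in \<open>J\<close> are seen to form a
  two-sided ideal: closure under right multiplication comes for free for a kernel.\<close>

lemma kernel_loc_quot_map:
  "a_kernel (left_loc R S) (left_loc (R Quot J) ((+>) J ` S)) (loc_quot_map R S J) = loc_ideal R S J"
  unfolding a_kernel_def' loc_ideal_def
  using loc_quot_map_eq_zero_iff a_subset by (auto simp del: left_loc_simps(2)) blast

lemma ideal_loc_ideal: "ideal (loc_ideal R S J) (left_loc R S)"
  using ring_hom_ring.kernel_is_ideal[OF loc_quot_map_hom] unfolding kernel_loc_quot_map .

text \<open>By definition, membership only yields some representation with numerator in
  \<open>J\<close>. The kernel description shows that every numerator lies in \<open>J\<close>, so
  the contraction to \<open>R\<close> is \<open>J\<close> again.\<close>

lemma frac_mem_loc_ideal_iff: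
  assumes "s \<in> S" "r \<in> carrier R"
  shows "frac R S s r \<in> loc_ideal R S J \<longleftrightarrow> r \<in> J"
  unfolding kernel_loc_quot_map[symmetric] a_kernel_def'
  using loc_quot_map_eq_zero_iff[OF assms] assms by (auto simp del: left_loc_simps(2))

lemma left_loc_quotient_iso:
  "\<exists>f \<in> ring_iso (left_loc (R Quot J) ((+>) J ` S)) (left_loc R S Quot loc_ideal R S J).
     \<forall>s\<in>S. \<forall>r\<in>carrier R. f (frac (R Quot J) ((+>) J ` S) (J +> s) (J +> r))
       = loc_ideal R S J +>\<^bsub>left_loc R S\<^esub> frac R S s r"
proof -
  interpret h: ring_hom_ring "left_loc R S" "left_loc (R Quot J) ((+>) J ` S)" "loc_quot_map R S J"
    by (rule loc_quot_map_hom)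
  interpret K: ideal "loc_ideal R S J" "left_loc R S"
    by (rule ideal_loc_ideal)
  define F where "F X = the_elem (loc_quot_map R S J ` X)" for X
  have F: "F \<in> ring_iso (left_loc R S Quot loc_ideal R S J) (left_loc (R Quot J) ((+>) J ` S))"
    using h.FactRing_iso_set[OF loc_quot_map_surj] unfolding kernel_loc_quot_map F_def .
  \<comment> \<open>The induced map \<open>F\<close> leaves the quotient, whereas the isomorphism
    claimed enters it.\<close>
  define f where "f = inv_into (carrier (left_loc R S Quot loc_ideal R S J)) F"
  have "f \<in> ring_iso (left_loc (R Quot J) ((+>) J ` S)) (left_loc R S Quot loc_ideal R S J)"
    unfolding f_def by (rule ring_iso_set_sym[OF K.quotient_is_ring F])
  moreover have "f (frac (R Quot J) ((+>) J ` S) (J +> s) (J +> r))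
       = loc_ideal R S J +>\<^bsub>left_loc R S\<^esub> frac R S s r" if sr: "s \<in> S" "r \<in> carrier R" for s r
  proof -
    have carr: "frac R S s r \<in> carrier (left_loc R S)" using sr by auto
    have "F (loc_ideal R S J +>\<^bsub>left_loc R S\<^esub> frac R S s r) = frac (R Quot J) ((+>) J ` S) (J +> s) (J +> r)"
      using h.the_elem_simp[OF carr] unfolding kernel_loc_quot_map F_def loc_quot_map_frac[OF sr] .
    moreover have "loc_ideal R S J +>\<^bsub>left_loc R S\<^esub> frac R S s r \<in> carrier (left_loc R S Quot loc_ideal R S J)"
      using ring_hom_closed[OF K.rcos_ring_hom carr] .
    moreover have "inj_on F (carrier (left_loc R S Quot loc_ideal R S J))"
      using F by (simp add: ring_iso_def bij_betw_def)
    ultimately show ?thesis unfolding f_def by (metis inv_into_f_f)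
  qed
  ultimately show ?thesis by blast
qed

text \<open>Here \<open>R/J\<close> is a left module over \<open>R\<close> localized at
  \<open>S\<close> itself, whereas \<open>Q\<close> localizes the ring \<open>R/J\<close> at the
  image of \<open>S\<close>.\<close>

sublocale N: left_den_module R S "quotient_module R J"
  rewrites "carrier (quotient_module R J) = carrier (R Quot J)"
    and "zero (quotient_module R J) = zero (R Quot J)"
    and "add (quotient_module R J) = add (R Quot J)"
    and "smult (quotient_module R J) = (\<lambda>r X. (J +> r) \<otimes>\<^bsub>R Quot J\<^esub> X)"
  using left_module_quotient[OF is_ideal]
  by (simp_all add: left_den_module_def left_den_axioms quotient_module_def)

lemma left_loc_module_quotient_iso:
  "\<exists>g \<in> left_module_iso (left_loc R S) (quotient_module (left_loc R S) (loc_ideal R S J))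
       (left_loc_module R S (quotient_module R J)).
     \<forall>s\<in>S. \<forall>r\<in>carrier R. g (loc_ideal R S J +>\<^bsub>left_loc R S\<^esub> frac R S s r)
       = mfrac R S (quotient_module R J) s (J +> r)"
proof -
  \<comment> \<open>The map sending \<open>s^-1 r\<close> to \<open>s^-1 (r + J)\<close>, written on
    classes as a union over representatives. Left cancellation modulo \<open>J\<close> will identify
    its kernel with \<open>loc_ideal R S J\<close>.\<close>
  define h where "h X = \<Union>{mfrac R S (quotient_module R J) s (J +> r) | s r. (s, r) \<in> X}" for X
  have h: "h (frac R S s r) = mfrac R S (quotient_module R J) s (J +> r)"
    if sr: "s \<in> S" "r \<in> carrier R" for s r
    unfolding h_def
  proof (rule Union_eq_witness, goal_cases)
    case 1
    show ?case by (intro CollectI exI conjI, rule refl) (use reg.mfrac_self sr in auto)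
  next
    case (2 B)
    then obtain t n where B: "B = mfrac R S (quotient_module R J) t (J +> n)"
      and tn: "(t, n) \<in> frac R S s r" by blast
    obtain c d where cd: "c \<otimes> s \<in> S" "c \<otimes> s = d \<otimes> t" "c \<otimes> r = d \<otimes> n"
      "t \<in> S" "n \<in> carrier R" "c \<in> carrier R" "d \<in> carrier R"
      using reg.mfracE[OF tn] .
    have "(J +> c) \<otimes>\<^bsub>R Quot J\<^esub> (J +> r) = (J +> d) \<otimes>\<^bsub>R Quot J\<^esub> (J +> n)"
      using cd sr by (simp add: quot.hom_mult[symmetric] del: quot.hom_mult)
    then have "(t, J +> n) \<in> mfrac R S (quotient_module R J) s (J +> r)"
      using cd N.mfracI[of c s d t "J +> r" "J +> n"] by auto
    then show ?case unfolding B
      using cd sr by (subst eq_commute, subst N.mfrac_eq_iff) auto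
  qed
  have "\<exists>g \<in> left_module_iso (left_loc R S) (quotient_module (left_loc R S) (loc_ideal R S J))
       (left_loc_module R S (quotient_module R J)).
     \<forall>x\<in>carrier (left_loc R S). g (loc_ideal R S J +>\<^bsub>left_loc R S\<^esub> x) = h x"
  proof (rule left_module_first_iso[OF N.left_module_loc ideal_loc_ideal])
    show *: "h \<in> carrier (left_loc R S) \<rightarrow> carrier (left_loc_module R S (quotient_module R J))"
      using quot.hom_closed by (fastforce simp: h quotient_module_def)
    show "h ` carrier (left_loc R S) = carrier (left_loc_module R S (quotient_module R J))"
    proof
      show "carrier (left_loc_module R S (quotient_module R J)) \<subseteq> h ` carrier (left_loc R S)"
        by (auto simp: quotient_module_def[of R J, THEN arg_cong[where f=carrier]] elim!: FactRing_carrierE simp flip: h intro!: imageI) blast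
    qed (use * in blast)
  next
    fix x y assume xy: "x \<in> carrier (left_loc R S)" "y \<in> carrier (left_loc R S)"
    then obtain s m n where "s \<in> S" "m \<in> carrier R" "n \<in> carrier R" "x = frac R S s m" "y = frac R S s n"
      using reg.common_denominator[of x y] by auto
    then show "h (x \<oplus>\<^bsub>left_loc R S\<^esub> y) = h x \<oplus>\<^bsub>left_loc_module R S (quotient_module R J)\<^esub> h y"
      by (simp add: h reg.mloc_add_same_denominator N.mloc_add_same_denominator)
    obtain s a t b where 1: "s \<in> S" "a \<in> carrier R" "t \<in> S" "b \<in> carrier R" "x = frac R S s a" "y = frac R S t b"
      using xy by auto
    obtain u c where u: "u \<in> S" "c \<in> carrier R" "u \<otimes> a = c \<otimes> t"
      using Ore[OF 1(2,3)] .
    then show "h (x \<otimes>\<^bsub>left_loc R S\<^esub> y) = x \<odot>\<^bsub>left_loc_module R S (quotient_module R J)\<^esub> h y"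
      using 1 by (simp add: h reg.mloc_smult_mfrac N.mloc_smult_mfrac)
  next
    fix x assume "x \<in> carrier (left_loc R S)"
    then obtain s r where sr: "s \<in> S" "r \<in> carrier R" "x = frac R S s r" by auto
    then have "h x = \<zero>\<^bsub>left_loc_module R S (quotient_module R J)\<^esub>
        \<longleftrightarrow> (\<exists>u\<in>S. (J +> u) \<otimes>\<^bsub>R Quot J\<^esub> (J +> r) = \<zero>\<^bsub>R Quot J\<^esub>)"
      using N.mfrac_eq_zero_iff[of s "J +> r"] by (simp add: h quotient_module_def)
    also have "\<dots> \<longleftrightarrow> r \<in> J"
      using sr S_one by (auto simp: quot.hom_mult[symmetric] rcos_eq_zero_iff left_mod_iff simp del: quot.hom_mult)
    finally show "h x = \<zero>\<^bsub>left_loc_module R S (quotient_module R J)\<^esub> \<longleftrightarrow> x \<in> loc_ideal R S J"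
      using frac_mem_loc_ideal_iff sr by simp
  qed
  then obtain g where g: "g \<in> left_module_iso (left_loc R S) (quotient_module (left_loc R S) (loc_ideal R S J))
       (left_loc_module R S (quotient_module R J))"
    and gx: "\<And>x. x \<in> carrier (left_loc R S) \<Longrightarrow> g (loc_ideal R S J +>\<^bsub>left_loc R S\<^esub> x) = h x"
    by blast
  show ?thesis
  proof (intro bexI[OF _ g] ballI)
    fix s r assume sr: "s \<in> S" "r \<in> carrier R"
    then have "frac R S s r \<in> carrier (left_loc R S)" by auto
    from gx[OF this] show "g (loc_ideal R S J +>\<^bsub>left_loc R S\<^esub> frac R S s r)
       = mfrac R S (quotient_module R J) s (J +> r)"
      unfolding h[OF sr] .
  qed
qed

end

section \<open>Noncommutative primes\<close>

lemma (in ring) idealI_closed: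
  assumes "I \<subseteq> carrier R" "\<zero> \<in> I" "\<And>x y. \<lbrakk>x \<in> I; y \<in> I\<rbrakk> \<Longrightarrow> x \<oplus> y \<in> I"
    and l: "\<And>x r. \<lbrakk>x \<in> I; r \<in> carrier R\<rbrakk> \<Longrightarrow> r \<otimes> x \<in> I"
    and "\<And>x r. \<lbrakk>x \<in> I; r \<in> carrier R\<rbrakk> \<Longrightarrow> x \<otimes> r \<in> I"
  shows "ideal I R"
proof (rule idealI[OF ring_axioms])
  have "\<ominus> x \<in> I" if "x \<in> I" for x
    using l[OF that, of "\<ominus> \<one>"] that assms(1) by (auto simp: l_minus)
  then show "subgroup I (add_monoid R)"
    using assms by (intro add.subgroupI) (auto simp: a_inv_def)
qed (use assms in auto)

text \<open>The arbitrary middle factor \<open>r\<close> absorbs a left factor of \<open>y\<close>,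
  which makes the set two-sided. Such colon ideals are used below in place of ideals generated by an
  element.\<close>

lemma (in ring) ideal_right_colon:
  assumes "ideal P R" "X \<subseteq> carrier R"
  shows "ideal {y \<in> carrier R. \<forall>x\<in>X. \<forall>r\<in>carrier R. x \<otimes> r \<otimes> y \<in> P} R"
proof -
  interpret P: ideal P R by fact
  have X: "x \<in> carrier R" if "x \<in> X" for x using assms that by blast
  show ?thesis
  proof (rule idealI_closed)
    fix y r assume y: "y \<in> {y \<in> carrier R. \<forall>x\<in>X. \<forall>r\<in>carrier R. x \<otimes> r \<otimes> y \<in> P}" and r: "r \<in> carrier R"
    have "x \<otimes> q \<otimes> (r \<otimes> y) = x \<otimes> (q \<otimes> r) \<otimes> y \<and> x \<otimes> q \<otimes> (y \<otimes> r) = x \<otimes> q \<otimes> y \<otimes> r"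
      if "x \<in> X" "q \<in> carrier R" for x q
      using that y r X by (simp add: m_assoc)
    then show "r \<otimes> y \<in> {y \<in> carrier R. \<forall>x\<in>X. \<forall>r\<in>carrier R. x \<otimes> r \<otimes> y \<in> P}"
      "y \<otimes> r \<in> {y \<in> carrier R. \<forall>x\<in>X. \<forall>r\<in>carrier R. x \<otimes> r \<otimes> y \<in> P}"
      using y r P.I_r_closed by auto
  qed (auto simp: X r_distr)
qed

lemma (in ring) ideal_left_colon:
  assumes "ideal P R" "Y \<subseteq> carrier R"
  shows "ideal {x \<in> carrier R. \<forall>y\<in>Y. \<forall>r\<in>carrier R. x \<otimes> r \<otimes> y \<in> P} R"
proof -
  interpret P: ideal P R by fact
  have Y: "y \<in> carrier R" if "y \<in> Y" for y using assms that by blast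
  show ?thesis
  proof (rule idealI_closed)
    fix x r assume x: "x \<in> {x \<in> carrier R. \<forall>y\<in>Y. \<forall>r\<in>carrier R. x \<otimes> r \<otimes> y \<in> P}" and r: "r \<in> carrier R"
    have "(x \<otimes> r) \<otimes> q \<otimes> y = x \<otimes> (r \<otimes> q) \<otimes> y \<and> (r \<otimes> x) \<otimes> q \<otimes> y = r \<otimes> (x \<otimes> q \<otimes> y)"
      if "y \<in> Y" "q \<in> carrier R" for y q
      using that x r Y by (simp add: m_assoc)
    then show "r \<otimes> x \<in> {x \<in> carrier R. \<forall>y\<in>Y. \<forall>r\<in>carrier R. x \<otimes> r \<otimes> y \<in> P}"
      "x \<otimes> r \<in> {x \<in> carrier R. \<forall>y\<in>Y. \<forall>r\<in>carrier R. x \<otimes> r \<otimes> y \<in> P}"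
      using x r P.I_l_closed by auto
  qed (auto simp: Y l_distr)
qed

lemma (in ring) prime_ideal_iff:
  "prime_ideal R P \<longleftrightarrow> ideal P R \<and> P \<noteq> carrier R \<and>
    (\<forall>a\<in>carrier R. \<forall>b\<in>carrier R. (\<forall>r\<in>carrier R. a \<otimes> r \<otimes> b \<in> P) \<longrightarrow> a \<in> P \<or> b \<in> P)"
proof (cases "ideal P R")
  case True
  then interpret P: ideal P R .
  have "(\<forall>I J. ideal I R \<longrightarrow> ideal J R \<longrightarrow> I \<cdot> J \<subseteq> P \<longrightarrow> I \<subseteq> P \<or> J \<subseteq> P) \<longleftrightarrow>
    (\<forall>a\<in>carrier R. \<forall>b\<in>carrier R. (\<forall>r\<in>carrier R. a \<otimes> r \<otimes> b \<in> P) \<longrightarrow> a \<in> P \<or> b \<in> P)"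
  proof (intro iffI allI ballI impI)
    fix a b
    assume prime: "\<forall>I J. ideal I R \<longrightarrow> ideal J R \<longrightarrow> I \<cdot> J \<subseteq> P \<longrightarrow> I \<subseteq> P \<or> J \<subseteq> P"
      and ab: "a \<in> carrier R" "b \<in> carrier R" "\<forall>r\<in>carrier R. a \<otimes> r \<otimes> b \<in> P"
    \<comment> \<open>\<open>a\<close> lies in \<open>I\<close> by hypothesis and \<open>b\<close>
      lies in \<open>J\<close> by the choice of \<open>I\<close>; taking the middle factor
      \<open>\<one>\<close> gives that the product of \<open>I\<close> and \<open>J\<close> is
      contained in \<open>P\<close>.\<close>
    define I where "I = {x \<in> carrier R. \<forall>y\<in>{b}. \<forall>r\<in>carrier R. x \<otimes> r \<otimes> y \<in> P}"
    define J where "J = {y \<in> carrier R. \<forall>x\<in>I. \<forall>r\<in>carrier R. x \<otimes> r \<otimes> y \<in> P}"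
    have "ideal I R"
      unfolding I_def by (rule ideal_left_colon[OF True]) (use ab in auto)
    moreover have "ideal J R"
      unfolding J_def by (rule ideal_right_colon[OF True]) (auto simp: I_def)
    moreover have "x \<in> P" if "x \<in> I \<cdot> J" for x
      using that
    proof induction
      case (prod i j)
      then have "i \<otimes> \<one> \<otimes> j \<in> P" unfolding J_def by blast
      moreover have "i \<in> carrier R" using prod unfolding I_def by blast
      ultimately show ?case by simp
    qed simp
    ultimately have "I \<subseteq> P \<or> J \<subseteq> P" using prime by blast
    moreover have "a \<in> I" "b \<in> J" using ab by (auto simp: I_def J_def)
    ultimately show "a \<in> P \<or> b \<in> P" by blast
  next
    fix I J
    assume prime: "\<forall>a\<in>carrier R. \<forall>b\<in>carrier R. (\<forall>r\<in>carrier R. a \<otimes> r \<otimes> b \<in> P) \<longrightarrow> a \<in> P \<or> b \<in> P"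
      and IJ: "ideal I R" "ideal J R" "I \<cdot> J \<subseteq> P"
    show "I \<subseteq> P \<or> J \<subseteq> P"
    proof (rule ccontr)
      assume "\<not> (I \<subseteq> P \<or> J \<subseteq> P)"
      then obtain a b where ab: "a \<in> I" "a \<notin> P" "b \<in> J" "b \<notin> P" by blast
      have "a \<otimes> r \<otimes> b \<in> P" if "r \<in> carrier R" for r
        using ideal_prod.prod[of "a \<otimes> r" I b J R] ab IJ that ideal.I_r_closed[OF IJ(1)] by blast
      then show False
        using prime ab ideal.Icarr[OF IJ(1)] ideal.Icarr[OF IJ(2)] by blast
    qed
  qed
  then show ?thesis unfolding prime_ideal_def by blast
qed (simp add: prime_ideal_def)

lemma (in ring) prime_idealD:
  assumes "prime_ideal R P" "a \<in> carrier R" "b \<in> carrier R" "a \<notin> P" "b \<notin> P"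
  obtains r where "r \<in> carrier R" "a \<otimes> r \<otimes> b \<notin> P"
  using assms unfolding prime_ideal_iff by blast

lemma prime_ideal_is_ideal: "prime_ideal R P \<Longrightarrow> ideal P R"
  by (simp add: prime_ideal_def)

lemma prime_ideal_subset: "prime_ideal R P \<Longrightarrow> P \<subseteq> carrier R"
  by (intro subsetI ideal.Icarr[OF prime_ideal_is_ideal])

lemma min_primes_prime: "P \<in> min_primes R \<Longrightarrow> prime_ideal R P"
  by (simp add: min_primes_def)

section \<open>Existence of primes by Zorn's lemma\<close>

lemma (in ring) ideal_Union_chain:
  assumes "C \<noteq> {}" "\<And>I. I \<in> C \<Longrightarrow> ideal I R" "\<And>I J. I \<in> C \<Longrightarrow> J \<in> C \<Longrightarrow> I \<subseteq> J \<or> J \<subseteq> I"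
  shows "ideal (\<Union>C) R"
proof (rule idealI_closed)
  show "\<Union>C \<subseteq> carrier R"
    using ideal.Icarr[OF assms(2)] by blast
  show "\<zero> \<in> \<Union>C"
    using assms(1) additive_subgroup.zero_closed[OF ideal.axioms(1)[OF assms(2)]] by blast
next
  fix x y assume "x \<in> \<Union>C" "y \<in> \<Union>C"
  then obtain I J where IJ: "I \<in> C" "J \<in> C" "x \<in> I" "y \<in> J" by blast
  then obtain K where K: "K \<in> C" "x \<in> K" "y \<in> K" using assms(3)[OF IJ(1,2)] by blast
  show "x \<oplus> y \<in> \<Union>C"
    using additive_subgroup.a_closed[OF ideal.axioms(1)[OF assms(2)[OF K(1)]] K(2,3)] K(1) by blast
next
  fix x r assume "x \<in> \<Union>C" and r: "r \<in> carrier R"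
  then obtain I where I: "I \<in> C" "x \<in> I" by blast
  show "r \<otimes> x \<in> \<Union>C" "x \<otimes> r \<in> \<Union>C"
    using ideal.I_l_closed[OF assms(2)[OF I(1)] I(2) r] ideal.I_r_closed[OF assms(2)[OF I(1)] I(2) r]
      I(1) by blast+
qed

text \<open>An ideal maximal among those disjoint from an m-system is prime, as for multiplicative
  sets in the commutative case.\<close>

lemma (in ring) prime_ideal_avoiding:
  assumes "M \<noteq> {}" "M \<subseteq> carrier R" "\<zero> \<notin> M"
    and M: "\<And>m n. m \<in> M \<Longrightarrow> n \<in> M \<Longrightarrow> \<exists>r\<in>carrier R. m \<otimes> r \<otimes> n \<in> M"
  obtains Q where "prime_ideal R Q" "Q \<inter> M = {}"
proof -
  define A where "A = {Q. ideal Q R \<and> Q \<inter> M = {}}"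
  have "A \<noteq> {}" using zeroideal assms(3) unfolding A_def by blast
  moreover have "\<Union>C \<in> A" if C: "C \<noteq> {}" "subset.chain A C" for C
    using ideal_Union_chain[of C] C unfolding A_def subset.chain_def subset_chain_def by blast
  ultimately obtain Q where Q: "Q \<in> A" and max: "\<And>X. X \<in> A \<Longrightarrow> Q \<subseteq> X \<Longrightarrow> X = Q"
    using subset_Zorn_nonempty[of A] by blast
  have QI: "ideal Q R" and QM: "Q \<inter> M = {}" using Q unfolding A_def by auto
  interpret Q: ideal Q R by (rule QI)
  have hit: "\<exists>m\<in>M. m \<in> X" if "ideal X R" "Q \<subseteq> X" "a \<in> X" "a \<notin> Q" for X a
    using max[of X] that unfolding A_def by blast
  have "prime_ideal R Q"
    unfolding prime_ideal_iff
  proof (intro conjI ballI impI QI)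
    show "Q \<noteq> carrier R" using QM assms by blast
  next
    fix a b assume ab: "a \<in> carrier R" "b \<in> carrier R" "\<forall>r\<in>carrier R. a \<otimes> r \<otimes> b \<in> Q"
    show "a \<in> Q \<or> b \<in> Q"
    proof (rule ccontr)
      assume nin: "\<not> (a \<in> Q \<or> b \<in> Q)"
      \<comment> \<open>\<open>X\<close> is strictly larger than \<open>Q\<close>, so by maximality
        it meets \<open>M\<close> in some \<open>m\<close>. The second colon ideal is formed with
        this \<open>m\<close> instead of \<open>a\<close>; it contains \<open>b\<close> because
        \<open>m\<close> is in \<open>X\<close>, hence meets \<open>M\<close> in some
        \<open>n\<close>. Then all products \<open>m \<otimes> r \<otimes> n\<close> lie in
        \<open>Q\<close>, although one of them lies in \<open>M\<close>.\<close>
      define X where "X = {x \<in> carrier R. \<forall>y\<in>{b}. \<forall>r\<in>carrier R. x \<otimes> r \<otimes> y \<in> Q}"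
      have "ideal X R" unfolding X_def by (rule ideal_left_colon[OF QI]) (use ab in auto)
      moreover have "Q \<subseteq> X" "a \<in> X"
        using ab Q.I_r_closed Q.Icarr unfolding X_def by auto
      ultimately obtain m where m: "m \<in> M" "m \<in> X" using hit nin by blast
      define Y where "Y = {y \<in> carrier R. \<forall>x\<in>{m}. \<forall>r\<in>carrier R. x \<otimes> r \<otimes> y \<in> Q}"
      have "ideal Y R" unfolding Y_def by (rule ideal_right_colon[OF QI]) (use m assms in auto)
      moreover have "Q \<subseteq> Y" "b \<in> Y"
        using ab m assms(2) Q.I_l_closed Q.Icarr unfolding X_def Y_def by auto
      ultimately obtain n where "n \<in> M" "n \<in> Y" using hit nin by blast
      then show False using M[OF m(1)] QM unfolding Y_def by blast
    qed
  qed
  then show thesis using that QM by blast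
qed

text \<open>Zorn's lemma for the complements of the primes below \<open>P\<close>.\<close>

lemma (in ring) min_prime_below:
  assumes "prime_ideal R P"
  obtains Q where "Q \<in> min_primes R" "Q \<subseteq> P"
proof -
  define A where "A = {carrier R - Q | Q. prime_ideal R Q \<and> Q \<subseteq> P}"
  note sub = prime_ideal_subset
  have "A \<noteq> {}" using assms unfolding A_def by blast
  moreover have "\<Union>C \<in> A" if C: "C \<noteq> {}" "subset.chain A C" for C
  proof -
    define D where "D = {Q. prime_ideal R Q \<and> Q \<subseteq> P \<and> carrier R - Q \<in> C}"
    have CA: "C \<subseteq> A" and chain: "\<And>X Y. X \<in> C \<Longrightarrow> Y \<in> C \<Longrightarrow> X \<subseteq> Y \<or> Y \<subseteq> X"
      using C(2) unfolding subset_chain_def by blast+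
    have CD: "C = (-) (carrier R) ` D"
      using CA unfolding A_def D_def by blast
    then have D: "D \<noteq> {}" using C(1) by blast
    \<comment> \<open>A union of complements is the complement of the intersection, so the upper
      bound of the chain is given by an intersection of a chain of primes, which has to be shown
      prime.\<close>
    have UC: "\<Union>C = carrier R - \<Inter>D" unfolding CD by blast
    have "prime_ideal R (\<Inter>D)"
      unfolding prime_ideal_iff
    proof (intro conjI ballI impI)
      show "ideal (\<Inter>D) R"
        using D prime_ideal_is_ideal unfolding D_def by (intro i_Intersect) auto
      show "\<Inter>D \<noteq> carrier R"
      proof -
        obtain Q where "Q \<in> D" using D by blast
        then show ?thesis using sub[of R Q] unfolding D_def prime_ideal_def by auto
      qed
    next
      fix a b assume ab: "a \<in> carrier R" "b \<in> carrier R" "\<forall>r\<in>carrier R. a \<otimes> r \<otimes> b \<in> \<Inter>D"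
      show "a \<in> \<Inter>D \<or> b \<in> \<Inter>D"
      proof (rule ccontr)
        assume "\<not> (a \<in> \<Inter>D \<or> b \<in> \<Inter>D)"
        then obtain Q1 Q2 where Q: "Q1 \<in> D" "Q2 \<in> D" "a \<notin> Q1" "b \<notin> Q2" by blast
        \<comment> \<open>The smaller of the two primes misses both \<open>a\<close> and
          \<open>b\<close>, and its own primeness then gives the contradiction.\<close>
        then have "Q1 \<subseteq> Q2 \<or> Q2 \<subseteq> Q1"
          using chain[of "carrier R - Q1" "carrier R - Q2"] sub[of R Q1] sub[of R Q2] unfolding D_def by blast
        then obtain Q where Q: "Q \<in> D" "a \<notin> Q" "b \<notin> Q" using Q by blast
        then obtain r where "r \<in> carrier R" "a \<otimes> r \<otimes> b \<notin> Q"
          using prime_idealD[of Q a b] ab(1,2) unfolding D_def by blast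
        then show False using ab(3) Q(1) by blast
      qed
    qed
    then show ?thesis unfolding A_def UC using D unfolding D_def by blast
  qed
  ultimately obtain X where X: "X \<in> A" and max: "\<And>Y. Y \<in> A \<Longrightarrow> X \<subseteq> Y \<Longrightarrow> Y = X"
    using subset_Zorn_nonempty[of A] by blast
  then obtain Q where Q: "prime_ideal R Q" "Q \<subseteq> P" "X = carrier R - Q" unfolding A_def by blast
  have "Q' = Q" if Q': "prime_ideal R Q'" "Q' \<subseteq> Q" for Q'
  proof -
    have "carrier R - Q' \<in> A" using Q' Q(2) unfolding A_def by blast
    then have "carrier R - Q' = carrier R - Q" using max Q' Q(3) by blast
    then show ?thesis using sub[OF Q(1)] sub[OF Q'(1)] by blast
  qed
  then show thesis using that Q unfolding min_primes_def by blast
qed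

text \<open>If \<open>a\<close> in \<open>I\<close> and \<open>b\<close> in all other members are
  outside \<open>P\<close>, some \<open>a \<otimes> r \<otimes> b\<close> is outside
  \<open>P\<close> but in every member. Intersecting with \<open>carrier R\<close> gives the empty
  family its proper meaning; that family occurs when there is only one minimal prime.\<close>

lemma (in ring) prime_ideal_finite_Inter:
  assumes P: "prime_ideal R P" and "finite F" "\<And>I. I \<in> F \<Longrightarrow> ideal I R"
    and "carrier R \<inter> \<Inter>F \<subseteq> P"
  obtains I where "I \<in> F" "I \<subseteq> P"
proof -
  have "\<exists>I\<in>F. I \<subseteq> P"
    using assms(2-)
  proof (induction F)
    case empty
    then show ?case using P prime_ideal_subset[OF P] unfolding prime_ideal_def by simp
  next
    case (insert I F)
    show ?case
    proof (rule ccontr)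
      assume nex: "\<not> (\<exists>I\<in>insert I F. I \<subseteq> P)"
      then obtain a where a: "a \<in> I" "a \<notin> P" by blast
      obtain b where b: "b \<in> carrier R" "b \<in> \<Inter>F" "b \<notin> P"
        using insert.IH insert.prems(1) nex by blast
      have I: "ideal I R" using insert.prems by blast
      have ac: "a \<in> carrier R" using ideal.Icarr[OF I a(1)] .
      obtain r where r: "r \<in> carrier R" "a \<otimes> r \<otimes> b \<notin> P"
        using prime_idealD[OF P ac b(1) a(2) b(3)] .
      have "a \<otimes> r \<otimes> b \<in> I"
        using ideal.I_r_closed[OF I] a b r by blast
      moreover have "a \<otimes> r \<otimes> b \<in> J" if "J \<in> F" for J
        using ideal.I_l_closed[of J R b "a \<otimes> r"] insert.prems(1) that b ac r by auto
      ultimately show False using insert.prems(2) ac b r by blast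
    qed
  qed
  then show thesis using that by blast
qed

lemma semiprime_min_primes_Inter:
  assumes "semiprime_ring R"
  shows "carrier R \<inter> \<Inter>(min_primes R) = {\<zero>\<^bsub>R\<^esub>}"
proof -
  interpret ring R using assms by (simp add: semiprime_ring_def)
  have "\<zero>\<^bsub>R\<^esub> \<in> P" if "P \<in> min_primes R" for P
    using additive_subgroup.zero_closed[OF ideal.axioms(1)[OF prime_ideal_is_ideal[OF min_primes_prime[OF that]]]] .
  moreover have "x \<in> \<Inter>{P. prime_ideal R P}" if "x \<in> \<Inter>(min_primes R)" for x
  proof (intro InterI, elim CollectE)
    fix P assume "prime_ideal R P"
    then obtain Q where "Q \<in> min_primes R" "Q \<subseteq> P" by (rule min_prime_below)
    then show "x \<in> P" using that by blast
  qed
  ultimately show ?thesis using assms unfolding semiprime_ring_def by blast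
qed

section \<open>Transport of primes along ring isomorphisms\<close>

definition vimage_ideal :: "('a, 'm) ring_scheme \<Rightarrow> ('a \<Rightarrow> 'b) \<Rightarrow> 'b set \<Rightarrow> 'a set" where
  "vimage_ideal A h Q = {x \<in> carrier A. h x \<in> Q}"

text \<open>Surjectivity carries the argument: the middle factor between \<open>h a\<close> and
  \<open>h b\<close> has to range over all of \<open>B\<close>, and an element outside
  \<open>Q\<close> must have a preimage.\<close>

lemma prime_ideal_vimage_iso:
  assumes "ring A" "ring B" and h: "h \<in> ring_iso A B" and Q: "prime_ideal B Q"
  shows "prime_ideal A (vimage_ideal A h Q)"
proof -
  interpret h: ring_hom_ring A B h
    using assms by (intro ring_hom_ringI2) (auto simp: ring_iso_def)
  have onto: "h ` carrier A = carrier B" using h by (auto simp: ring_iso_def bij_betw_def)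
  interpret Q: ideal Q B by (rule prime_ideal_is_ideal[OF Q])
  show ?thesis
    unfolding h.R.prime_ideal_iff
  proof (intro conjI ballI impI)
    show "ideal (vimage_ideal A h Q) A"
      unfolding vimage_ideal_def by (rule h.ideal_vimage[OF Q.is_ideal])
    obtain y where y: "y \<in> carrier B" "y \<notin> Q"
      using Q Q.Icarr unfolding prime_ideal_def by blast
    then obtain x where "x \<in> carrier A" "y = h x"
      unfolding onto[symmetric] by blast
    then show "vimage_ideal A h Q \<noteq> carrier A"
      using y(2) unfolding vimage_ideal_def by blast
  next
    fix a b assume ab: "a \<in> carrier A" "b \<in> carrier A"
      and abQ: "\<forall>r\<in>carrier A. a \<otimes>\<^bsub>A\<^esub> r \<otimes>\<^bsub>A\<^esub> b \<in> vimage_ideal A h Q"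
    have "h a \<otimes>\<^bsub>B\<^esub> r \<otimes>\<^bsub>B\<^esub> h b \<in> Q" if r: "r \<in> carrier B" for r
    proof -
      obtain q where q: "q \<in> carrier A" "r = h q" using r unfolding onto[symmetric] by blast
      then have "h (a \<otimes>\<^bsub>A\<^esub> q \<otimes>\<^bsub>A\<^esub> b) \<in> Q" using abQ unfolding vimage_ideal_def by blast
      then show ?thesis using ab q by simp
    qed
    then show "a \<in> vimage_ideal A h Q \<or> b \<in> vimage_ideal A h Q"
      using Q[unfolded h.S.prime_ideal_iff] ab unfolding vimage_ideal_def by simp
  qed
qed

lemma image_vimage_ideal:
  assumes "h \<in> ring_iso A B" "Q \<subseteq> carrier B"
  shows "h ` vimage_ideal A h Q = Q"
proof -
  have "carrier B = h ` carrier A" using assms(1) by (auto simp: ring_iso_def bij_betw_def)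
  then have "Q \<subseteq> h ` carrier A" using assms(2) by simp
  then show ?thesis unfolding vimage_ideal_def by auto
qed

lemma vimage_ideal_inv:
  assumes "h \<in> ring_iso A B" "P \<subseteq> carrier A"
  shows "vimage_ideal A h (vimage_ideal B (inv_into (carrier A) h) P) = P"
proof -
  have "bij_betw h (carrier A) (carrier B)" using assms(1) by (simp add: ring_iso_def)
  then have "inv_into (carrier A) h (h x) = x \<and> h x \<in> carrier B" if "x \<in> carrier A" for x
    using that by (auto simp: bij_betw_def)
  then show ?thesis using assms(2) unfolding vimage_ideal_def by auto
qed

lemma min_primes_vimage_iso:
  assumes "ring A" "ring B" and h: "h \<in> ring_iso A B"
  shows "bij_betw (vimage_ideal A h) (min_primes B) (min_primes A)"
proof (rule bij_betw_imageI)
  note vp = prime_ideal_vimage_iso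
  define k where "k = inv_into (carrier A) h"
  have k: "k \<in> ring_iso B A" unfolding k_def by (rule ring_iso_set_sym[OF assms(1) h])
  have hk: "vimage_ideal A h (vimage_ideal B k P) = P" if "prime_ideal A P" for P
    unfolding k_def by (rule vimage_ideal_inv[OF h prime_ideal_subset[OF that]])
  have img: "h ` vimage_ideal A h Q = Q" if "prime_ideal B Q" for Q
    by (rule image_vimage_ideal[OF h prime_ideal_subset[OF that]])
  have mono: "vimage_ideal X f P \<subseteq> vimage_ideal X f Q" if "P \<subseteq> Q" for X :: "('x, 'y) ring_scheme" and f :: "'x \<Rightarrow> 'z" and P Q
    using that unfolding vimage_ideal_def by blast
  show "inj_on (vimage_ideal A h) (min_primes B)"
    using img min_primes_prime by (metis inj_onI)
  show "vimage_ideal A h ` min_primes B = min_primes A"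
  proof (intro equalityI subsetI)
    fix P assume "P \<in> vimage_ideal A h ` min_primes B"
    then obtain Q where Q: "Q \<in> min_primes B" "P = vimage_ideal A h Q" by blast
    show "P \<in> min_primes A"
      unfolding min_primes_def mem_Collect_eq
    proof (intro conjI allI impI)
      show "prime_ideal A P"
        unfolding Q(2) by (rule vp[OF assms min_primes_prime[OF Q(1)]])
    next
      fix P' assume P': "prime_ideal A P'" "P' \<subseteq> P"
      have "vimage_ideal B k P' \<subseteq> Q"
        using img[OF min_primes_prime[OF Q(1)]] img[OF vp[OF assms(2,1) k P'(1)]]
          hk[OF P'(1)] P'(2) Q(2) by (metis image_mono)
      then have "vimage_ideal B k P' = Q"
        using vp[OF assms(2,1) k P'(1)] Q(1) unfolding min_primes_def by blast
      then show "P' = P" using hk[OF P'(1)] Q(2) by simp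
    qed
  next
    fix P assume P: "P \<in> min_primes A"
    note pP = min_primes_prime[OF P]
    have "vimage_ideal B k P \<in> min_primes B"
      unfolding min_primes_def mem_Collect_eq
    proof (intro conjI allI impI)
      show "prime_ideal B (vimage_ideal B k P)"
        by (rule vp[OF assms(2,1) k pP])
    next
      fix Q assume Q: "prime_ideal B Q" "Q \<subseteq> vimage_ideal B k P"
      have "vimage_ideal A h Q \<subseteq> P" using mono[OF Q(2)] hk[OF pP] by metis
      then have "vimage_ideal A h Q = P"
        using vp[OF assms Q(1)] P unfolding min_primes_def by blast
      then show "Q = vimage_ideal B k P"
        using img[OF Q(1)] img[OF vp[OF assms(2,1) k pP]] hk[OF pP] by metis
    qed
    then show "P \<in> vimage_ideal A h ` min_primes B" using hk[OF pP] by force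
  qed
qed

lemma semiprime_ring_iso:
  assumes "ring A" "semiprime_ring B" and h: "h \<in> ring_iso A B"
  shows "semiprime_ring A"
proof -
  have B: "ring B" using assms by (simp add: semiprime_ring_def)
  interpret h: ring_hom_ring A B h
    using assms(1) B h by (intro ring_hom_ringI2) (auto simp: ring_iso_def)
  have "x = \<zero>\<^bsub>A\<^esub>" if x: "x \<in> carrier A" "\<And>P. prime_ideal A P \<Longrightarrow> x \<in> P" for x
  proof -
    have "h x \<in> Q" if "prime_ideal B Q" for Q
      using x(2)[OF prime_ideal_vimage_iso[OF assms(1) B h that]] unfolding vimage_ideal_def by blast
    then have "h x = h \<zero>\<^bsub>A\<^esub>"
      using assms(2) x(1) unfolding semiprime_ring_def by auto
    then show ?thesis
      using h x(1) unfolding ring_iso_def bij_betw_def inj_on_def by auto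
  qed
  moreover have "\<zero>\<^bsub>A\<^esub> \<in> P" if "prime_ideal A P" for P
    using additive_subgroup.zero_closed[OF ideal.axioms(1)[OF prime_ideal_is_ideal[OF that]]] .
  ultimately show ?thesis using assms(1) unfolding semiprime_ring_def by auto
qed

section \<open>Primes of the localization\<close>

context left_den
begin

lemma frac_mult_one:
  assumes "s \<in> S" "a \<in> carrier R" "b \<in> carrier R"
  shows "frac R S s a \<otimes>\<^bsub>left_loc R S\<^esub> frac R S \<one> b = frac R S s (a \<otimes> b)"
  using assms reg.mloc_smult_mfrac[of s a \<one> b \<one> a] by simp

lemma denominator_mult_frac:
  assumes "s \<in> S" "a \<in> carrier R"
  shows "frac R S \<one> s \<otimes>\<^bsub>left_loc R S\<^esub> frac R S s a = frac R S \<one> a"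
  using assms reg.mloc_smult_mfrac[of \<one> s s a \<one> \<one>] by simp

lemma one_over_mult_frac:
  assumes "s \<in> S" "a \<in> carrier R"
  shows "frac R S s \<one> \<otimes>\<^bsub>left_loc R S\<^esub> frac R S \<one> a = frac R S s a"
  using frac_mult_one[of s \<one> a] assms by simp

lemma frac_carrier: "s \<in> S \<Longrightarrow> a \<in> carrier R \<Longrightarrow> frac R S s a \<in> carrier (left_loc R S)"
  by auto

lemma left_loc_carrierE:
  assumes "x \<in> carrier (left_loc R S)"
  obtains s a where "s \<in> S" "a \<in> carrier R" "x = frac R S s a"
  using assms by auto

text \<open>Left multiplication by \<open>s\<close> and by its inverse shows that an ideal sees only
  the numerator.\<close>

lemma ideal_left_loc_frac_iff:
  assumes "ideal Q (left_loc R S)" "s \<in> S" "a \<in> carrier R"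
  shows "frac R S s a \<in> Q \<longleftrightarrow> frac R S \<one> a \<in> Q"
  using ideal.I_l_closed[OF assms(1), of "frac R S s a" "frac R S \<one> s"]
    ideal.I_l_closed[OF assms(1), of "frac R S \<one> a" "frac R S s \<one>"]
    denominator_mult_frac[OF assms(2,3)] one_over_mult_frac[OF assms(2,3)]
    frac_carrier[of \<one> s] frac_carrier[of s \<one>] assms(2)
  by auto

end

section \<open>Semiprimeness when the denominators are regular\<close>

locale left_den_zero = left_den R S for R (structure) and S +
  assumes ass_zero: "ass_l R S = {\<zero>}"
begin

lemma left_regular: "\<lbrakk>s \<in> S; r \<in> carrier R; s \<otimes> r = \<zero>\<rbrakk> \<Longrightarrow> r = \<zero>"
  using ass_zero unfolding ass_l_def by blast

lemma right_regular:
  assumes "s \<in> S" "r \<in> carrier R" "r \<otimes> s = \<zero>"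
  shows "r = \<zero>"
  using annihilator_right[OF assms(2,1,3)] left_regular[OF _ assms(2)] by auto

lemma frac_eq_zero_iff:
  assumes "s \<in> S" "r \<in> carrier R"
  shows "frac R S s r = \<zero>\<^bsub>left_loc R S\<^esub> \<longleftrightarrow> r = \<zero>"
proof -
  have "(\<exists>u\<in>S. u \<otimes> r = \<zero>) \<longleftrightarrow> r = \<zero>"
    using left_regular[OF _ assms(2)] r_null[OF one_closed] S_one by blast
  then show ?thesis using reg.mfrac_eq_zero_iff[OF assms] by simp
qed

lemma semiprime_left_loc:
  assumes "semiprime_ring R"
  shows "semiprime_ring (left_loc R S)"
proof -
  interpret L: ring "left_loc R S" by (rule ring_left_loc)
  have "X = \<zero>\<^bsub>left_loc R S\<^esub>"
    if X: "X \<in> carrier (left_loc R S)" and primes: "\<And>Q. prime_ideal (left_loc R S) Q \<Longrightarrow> X \<in> Q" for X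
  proof (rule ccontr)
    assume "X \<noteq> \<zero>\<^bsub>left_loc R S\<^esub>"
    moreover obtain s x where sx: "s \<in> S" "x \<in> carrier R" "X = frac R S s x"
      using left_loc_carrierE[OF X] .
    ultimately have "x \<noteq> \<zero>" using frac_eq_zero_iff[OF sx(1,2)] by blast
    \<comment> \<open>As the denominators are regular, a nonzero fraction has a nonzero numerator,
      and semiprimeness of \<open>R\<close> provides a prime that misses it.\<close>
    then obtain P where P: "prime_ideal R P" "x \<notin> P"
      using assms sx(2) unfolding semiprime_ring_def by blast
    interpret P: ideal P R by (rule prime_ideal_is_ideal[OF P(1)])
    \<comment> \<open>Denominator \<open>\<one>\<close> is enough: a prime containing
      \<open>X\<close> also contains \<open>frac R S \<one> x\<close>, which lies in
      \<open>M\<close>. Zero stays outside \<open>M\<close> because \<open>R\<close> embeds into its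
      localization.\<close>
    define M where "M = {frac R S \<one> r | r. r \<in> carrier R \<and> r \<notin> P}"
    have xM: "frac R S \<one> x \<in> M" unfolding M_def using sx(2) P(2) by blast
    have zM: "\<zero>\<^bsub>left_loc R S\<^esub> \<notin> M"
    proof
      assume "\<zero>\<^bsub>left_loc R S\<^esub> \<in> M"
      then obtain r where r: "r \<in> carrier R" "r \<notin> P" and z: "\<zero>\<^bsub>left_loc R S\<^esub> = frac R S \<one> r"
        unfolding M_def by blast
      then have "r = \<zero>" using frac_eq_zero_iff[OF S_one r(1)] by simp
      then show False using r(2) P.zero_closed by simp
    qed
    obtain Q where Q: "prime_ideal (left_loc R S) Q" "Q \<inter> M = {}"
    proof (rule L.prime_ideal_avoiding)
      show "M \<noteq> {}" using xM by blast
      show "M \<subseteq> carrier (left_loc R S)" unfolding M_def using frac_carrier[OF S_one] by blast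
      show "\<zero>\<^bsub>left_loc R S\<^esub> \<notin> M" by (rule zM)
    next
      fix m n assume "m \<in> M" "n \<in> M"
      then obtain a b where ab: "a \<in> carrier R" "a \<notin> P" "m = frac R S \<one> a"
        "b \<in> carrier R" "b \<notin> P" "n = frac R S \<one> b"
        unfolding M_def by blast
      obtain r where r: "r \<in> carrier R" "a \<otimes> r \<otimes> b \<notin> P"
        using prime_idealD[OF P(1) ab(1,4,2,5)] .
      have "m \<otimes>\<^bsub>left_loc R S\<^esub> frac R S \<one> r \<otimes>\<^bsub>left_loc R S\<^esub> n = frac R S \<one> (a \<otimes> r \<otimes> b)"
        unfolding ab(3,6) using ab r
        by (simp add: frac_mult_one del: left_loc_simps)
      then show "\<exists>r\<in>carrier (left_loc R S). m \<otimes>\<^bsub>left_loc R S\<^esub> r \<otimes>\<^bsub>left_loc R S\<^esub> n \<in> M"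
        using r ab unfolding M_def by (intro bexI[OF _ frac_carrier[OF S_one r(1)]]) auto
    qed
    have "frac R S \<one> x \<in> Q"
      using primes[OF Q(1)] ideal_left_loc_frac_iff[OF prime_ideal_is_ideal[OF Q(1)] sx(1,2)] sx(3) by simp
    then show False using xM Q(2) by blast
  qed
  moreover have "\<zero>\<^bsub>left_loc R S\<^esub> \<in> Q" if "prime_ideal (left_loc R S) Q" for Q
    using additive_subgroup.zero_closed[OF ideal.axioms(1)[OF prime_ideal_is_ideal[OF that]]] .
  ultimately show ?thesis
    unfolding semiprime_ring_def using ring_left_loc L.zero_closed
    by (auto simp del: left_loc_simps)
qed

end

lemma (in left_den_quotient) prime_loc_ideal:
  assumes "prime_ideal R J"
  shows "prime_ideal (left_loc R S) (loc_ideal R S J)"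
proof -
  interpret L: ring "left_loc R S" by (rule ring_left_loc)
  show ?thesis
    unfolding L.prime_ideal_iff
  proof (intro conjI ballI impI)
    show "ideal (loc_ideal R S J) (left_loc R S)" by (rule ideal_loc_ideal)
    show "loc_ideal R S J \<noteq> carrier (left_loc R S)"
      using frac_mem_loc_ideal_iff[OF S_one one_closed] J_proper frac_carrier[OF S_one one_closed] by blast
  next
    fix X Y assume XY: "X \<in> carrier (left_loc R S)" "Y \<in> carrier (left_loc R S)"
      and all: "\<forall>Z\<in>carrier (left_loc R S). X \<otimes>\<^bsub>left_loc R S\<^esub> Z \<otimes>\<^bsub>left_loc R S\<^esub> Y \<in> loc_ideal R S J"
    obtain s a where sa: "s \<in> S" "a \<in> carrier R" "X = frac R S s a" using left_loc_carrierE[OF XY(1)] .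
    obtain t b where tb: "t \<in> S" "b \<in> carrier R" "Y = frac R S t b" using left_loc_carrierE[OF XY(2)] .
    have "a \<otimes> r \<otimes> b \<in> J" if r: "r \<in> carrier R" for r
    proof -
      \<comment> \<open>The factor with numerator \<open>t\<close> cancels the denominator of
        \<open>Y\<close>, so that the test element \<open>r\<close> ends up between the bare
        numerators \<open>a\<close> and \<open>b\<close>.\<close>
      have "X \<otimes>\<^bsub>left_loc R S\<^esub> (frac R S \<one> r \<otimes>\<^bsub>left_loc R S\<^esub> frac R S \<one> t) \<otimes>\<^bsub>left_loc R S\<^esub> Y
          = X \<otimes>\<^bsub>left_loc R S\<^esub> frac R S \<one> r \<otimes>\<^bsub>left_loc R S\<^esub> (frac R S \<one> t \<otimes>\<^bsub>left_loc R S\<^esub> Y)"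
        using XY r tb(1) frac_carrier[OF S_one] by (simp add: L.m_assoc del: left_loc_simps)
      also have "\<dots> = frac R S s (a \<otimes> r \<otimes> b)"
        unfolding tb(3) sa(3) using sa(1,2) tb(1,2) r
        by (simp add: denominator_mult_frac frac_mult_one del: left_loc_simps)
      finally have "frac R S s (a \<otimes> r \<otimes> b) \<in> loc_ideal R S J"
        using all L.m_closed[OF frac_carrier[OF S_one r] frac_carrier[OF S_one S_carrier[OF tb(1)]]] by metis
      then show ?thesis using frac_mem_loc_ideal_iff sa tb r by simp
    qed
    then show "X \<in> loc_ideal R S J \<or> Y \<in> loc_ideal R S J"
      using assms sa tb frac_mem_loc_ideal_iff unfolding prime_ideal_iff by auto
  qed
qed

section \<open>Finitely many minimal primes\<close>

locale left_den_semiprime = left_den_zero +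
  assumes semiprime: "semiprime_ring R" and finite_min: "finite (min_primes R)"
begin

text \<open>For an element \<open>y\<close> outside \<open>P\<close> of the intersection of the other minimal primes, \<open>s r \<in> P\<close> gives
  \<open>s r R y = 0\<close>, hence \<open>r R y = 0\<close> and \<open>r \<in> P\<close>; symmetrically for \<open>r s \<in> P\<close>.\<close>

lemma left_den_quotient_min_prime:
  assumes P: "P \<in> min_primes R"
  shows "left_den_quotient R S P"
proof -
  note pP = min_primes_prime[OF P]
  interpret P: ideal P R by (rule prime_ideal_is_ideal[OF pP])
  have ideals: "ideal I R" if "I \<in> min_primes R" for I
    using prime_ideal_is_ideal[OF min_primes_prime[OF that]] .
  \<comment> \<open>Otherwise the prime \<open>P\<close> would contain another member of the finite
    family, against minimality.\<close>
  have "\<not> carrier R \<inter> \<Inter>(min_primes R - {P}) \<subseteq> P"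
  proof
    assume "carrier R \<inter> \<Inter>(min_primes R - {P}) \<subseteq> P"
    then obtain I where "I \<in> min_primes R - {P}" "I \<subseteq> P"
      using prime_ideal_finite_Inter[OF pP, of "min_primes R - {P}"] finite_min ideals by blast
    then show False using P unfolding min_primes_def by blast
  qed
  then obtain y where y: "y \<in> carrier R" "y \<notin> P" "\<And>I. I \<in> min_primes R \<Longrightarrow> I \<noteq> P \<Longrightarrow> y \<in> I"
    by blast
  \<comment> \<open>Every minimal prime other than \<open>P\<close> contains \<open>y\<close>, so
    such a \<open>z\<close> lies in all minimal primes, which intersect in zero.\<close>
  have zero: "z = \<zero>"
    if "z \<in> carrier R" "z \<in> P" "\<And>I. I \<in> min_primes R \<Longrightarrow> y \<in> I \<Longrightarrow> z \<in> I" for z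
    using semiprime_min_primes_Inter[OF semiprime] that y by blast
  show ?thesis
  proof
    show "\<one> \<notin> P"
      using pP P.I_l_closed[of \<one>] P.Icarr unfolding prime_ideal_def by force
  next
    fix s r assume s: "s \<in> S" and r: "r \<in> carrier R" and sr: "s \<otimes> r \<in> P"
    have "r \<otimes> x \<otimes> y = \<zero>" if x: "x \<in> carrier R" for x
    proof -
      have "s \<otimes> (r \<otimes> x \<otimes> y) = \<zero>"
      proof (rule zero)
        have "s \<otimes> (r \<otimes> x \<otimes> y) = s \<otimes> r \<otimes> (x \<otimes> y)"
          using s r x y by (simp add: m_assoc)
        then show "s \<otimes> (r \<otimes> x \<otimes> y) \<in> P" using P.I_r_closed[OF sr] x y by simp
      next
        fix I assume I: "I \<in> min_primes R" "y \<in> I"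
        show "s \<otimes> (r \<otimes> x \<otimes> y) \<in> I"
          using ideal.I_l_closed[OF ideals[OF I(1)] I(2), of "s \<otimes> r \<otimes> x"] s r x y by (simp add: m_assoc)
      qed (use s r x y in auto)
      then show ?thesis using left_regular[OF s] r x y by simp
    qed
    then have "\<forall>x\<in>carrier R. r \<otimes> x \<otimes> y \<in> P" by simp
    then show "r \<in> P" using prime_idealD[OF pP r y(1)] y(2) by blast
  next
    fix s r assume s: "s \<in> S" and r: "r \<in> carrier R" and rs: "r \<otimes> s \<in> P"
    have "y \<otimes> x \<otimes> r = \<zero>" if x: "x \<in> carrier R" for x
    proof -
      have "(y \<otimes> x \<otimes> r) \<otimes> s = \<zero>"
      proof (rule zero)
        have "(y \<otimes> x \<otimes> r) \<otimes> s = (y \<otimes> x) \<otimes> (r \<otimes> s)"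
          using s r x y by (simp add: m_assoc)
        then show "(y \<otimes> x \<otimes> r) \<otimes> s \<in> P" using P.I_l_closed[OF rs] x y by simp
      next
        fix I assume I: "I \<in> min_primes R" "y \<in> I"
        show "(y \<otimes> x \<otimes> r) \<otimes> s \<in> I"
          using ideal.I_r_closed[OF ideals[OF I(1)] I(2), of "x \<otimes> r \<otimes> s"] s r x y by (simp add: m_assoc)
      qed (use s r x y in auto)
      then show ?thesis using right_regular[OF s] r x y by simp
    qed
    then have "\<forall>x\<in>carrier R. y \<otimes> x \<otimes> r \<in> P" by simp
    then show "r \<in> P" using prime_idealD[OF pP y(1) r y(2)] by blast
  qed
qed

lemma frac_mem_loc_min_prime_iff:
  assumes "P \<in> min_primes R" "s \<in> S" "r \<in> carrier R"
  shows "frac R S s r \<in> loc_ideal R S P \<longleftrightarrow> r \<in> P"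
  using left_den_quotient.frac_mem_loc_ideal_iff[OF left_den_quotient_min_prime[OF assms(1)] assms(2,3)] .

text \<open>Contraction to numerators over \<open>\<one>\<close> recovers the prime. This gives
  injectivity below and turns minimality in \<open>R\<close> into minimality in the
  localization.\<close>

lemma loc_min_prime_mono_iff:
  assumes "P \<in> min_primes R" "P' \<in> min_primes R"
  shows "loc_ideal R S P \<subseteq> loc_ideal R S P' \<longleftrightarrow> P \<subseteq> P'"
proof
  assume "loc_ideal R S P \<subseteq> loc_ideal R S P'"
  then show "P \<subseteq> P'"
    using frac_mem_loc_min_prime_iff[OF assms(1) S_one] frac_mem_loc_min_prime_iff[OF assms(2) S_one]
      prime_ideal_subset[OF min_primes_prime[OF assms(1)]] by blast
qed (auto simp: loc_ideal_def)

lemma loc_min_primes_below: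
  assumes Q: "prime_ideal (left_loc R S) Q"
  obtains P where "P \<in> min_primes R" "loc_ideal R S P \<subseteq> Q"
proof -
  interpret L: ring "left_loc R S" by (rule ring_left_loc)
  interpret Q: ideal Q "left_loc R S" by (rule prime_ideal_is_ideal[OF Q])
  obtain K where "K \<in> loc_ideal R S ` min_primes R" "K \<subseteq> Q"
  proof (rule L.prime_ideal_finite_Inter[OF Q])
    show "finite (loc_ideal R S ` min_primes R)" using finite_min by blast
    show "ideal I (left_loc R S)" if "I \<in> loc_ideal R S ` min_primes R" for I
      using that left_den_quotient.ideal_loc_ideal[OF left_den_quotient_min_prime] by blast
    show "carrier (left_loc R S) \<inter> \<Inter>(loc_ideal R S ` min_primes R) \<subseteq> Q"
    proof
      fix X assume X: "X \<in> carrier (left_loc R S) \<inter> \<Inter>(loc_ideal R S ` min_primes R)"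
      then obtain s r where sr: "s \<in> S" "r \<in> carrier R" "X = frac R S s r"
        using left_loc_carrierE[of X] by blast
      then have "r \<in> carrier R \<inter> \<Inter>(min_primes R)"
        using X frac_mem_loc_min_prime_iff by blast
      then have "r = \<zero>" using semiprime_min_primes_Inter[OF semiprime] by simp
      then show "X \<in> Q" using Q.zero_closed sr frac_eq_zero_iff[OF sr(1,2)] by simp
    qed
  qed
  then show thesis using that by blast
qed

theorem bij_betw_loc_min_primes:
  "bij_betw (loc_ideal R S) (min_primes R) (min_primes (left_loc R S))"
proof (rule bij_betw_imageI)
  have prime: "prime_ideal (left_loc R S) (loc_ideal R S P)" if "P \<in> min_primes R" for P
    using left_den_quotient.prime_loc_ideal[OF left_den_quotient_min_prime[OF that] min_primes_prime[OF that]] .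
  show "inj_on (loc_ideal R S) (min_primes R)"
    using loc_min_prime_mono_iff by (intro inj_onI equalityI) auto
  show "loc_ideal R S ` min_primes R = min_primes (left_loc R S)"
  proof (intro equalityI subsetI)
    fix K assume "K \<in> loc_ideal R S ` min_primes R"
    then obtain P where P: "P \<in> min_primes R" "K = loc_ideal R S P" by blast
    \<comment> \<open>\<open>Q\<close> contains the localization of some minimal prime
      \<open>P'\<close>. Then \<open>P' \<subseteq> P\<close>, so \<open>P' = P\<close> by
      minimality and \<open>Q\<close> is squeezed between equal ideals.\<close>
    have "Q = K" if Q: "prime_ideal (left_loc R S) Q" "Q \<subseteq> K" for Q
    proof -
      obtain P' where P': "P' \<in> min_primes R" "loc_ideal R S P' \<subseteq> Q"
        using loc_min_primes_below[OF Q(1)] .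
      then have "P' \<subseteq> P" using loc_min_prime_mono_iff[OF P'(1) P(1)] Q(2) P(2) by blast
      then have "P' = P" using P(1) P'(1) unfolding min_primes_def by blast
      then show ?thesis using P' P Q by blast
    qed
    then show "K \<in> min_primes (left_loc R S)"
      using prime[OF P(1)] P(2) unfolding min_primes_def by blast
  next
    fix K assume K: "K \<in> min_primes (left_loc R S)"
    obtain P where P: "P \<in> min_primes R" "loc_ideal R S P \<subseteq> K"
      using loc_min_primes_below[OF min_primes_prime[OF K]] .
    then have "loc_ideal R S P = K" using prime[OF P(1)] K unfolding min_primes_def by blast
    then show "K \<in> loc_ideal R S ` min_primes R" using P(1) by blast
  qed
qed

end

section \<open>Return from the quotient to the original ring\<close>

lemma loc_ideal_pull_eq_vimage:
  "loc_ideal_pull R S I P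
    = vimage_ideal (left_loc R S) (loc_quot_map R S I) (loc_ideal (R Quot I) ((\<lambda>s. I +>\<^bsub>R\<^esub> s) ` S) P)"
  by (simp add: loc_ideal_pull_def vimage_ideal_def)

text \<open>Left cancellation composes two annihilating multipliers. For right cancellation,
  \<open>t \<otimes> r \<otimes> s = \<zero>\<close> is turned by the denominator condition into
  \<open>u \<otimes> t \<otimes> r = \<zero>\<close>.\<close>

lemma left_den_quotient_ass:
  assumes "ring R" "S \<in> Den_l R I" "ideal I R"
  shows "left_den_quotient R S I"
proof -
  interpret I: ideal I R by fact
  interpret left_den R S
    using assms by (simp add: left_den_def left_den_axioms_def Den_l_def)
  have I_iff: "r \<in> I \<longleftrightarrow> r \<in> carrier R \<and> (\<exists>t\<in>S. t \<otimes>\<^bsub>R\<^esub> r = \<zero>\<^bsub>R\<^esub>)" for r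
    using assms(2) by (auto simp: Den_l_def ass_l_def)
  show ?thesis
  proof
    show "\<one>\<^bsub>R\<^esub> \<notin> I" unfolding I_iff using zero_notin by auto
  next
    fix s r assume s: "s \<in> S" and r: "r \<in> carrier R"
    {
      assume "s \<otimes>\<^bsub>R\<^esub> r \<in> I"
      then obtain t where t: "t \<in> S" "t \<otimes>\<^bsub>R\<^esub> (s \<otimes>\<^bsub>R\<^esub> r) = \<zero>\<^bsub>R\<^esub>"
        using I_iff by blast
      then have "(t \<otimes>\<^bsub>R\<^esub> s) \<otimes>\<^bsub>R\<^esub> r = \<zero>\<^bsub>R\<^esub>" using s r by (simp add: I.m_assoc)
      then show "r \<in> I" using I_iff r s t S_mult by blast
    next
      assume "r \<otimes>\<^bsub>R\<^esub> s \<in> I"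
      then obtain t where t: "t \<in> S" "t \<otimes>\<^bsub>R\<^esub> (r \<otimes>\<^bsub>R\<^esub> s) = \<zero>\<^bsub>R\<^esub>"
        using I_iff by blast
      then have "(t \<otimes>\<^bsub>R\<^esub> r) \<otimes>\<^bsub>R\<^esub> s = \<zero>\<^bsub>R\<^esub>" using s r by (simp add: I.m_assoc)
      then obtain u where u: "u \<in> S" "u \<otimes>\<^bsub>R\<^esub> (t \<otimes>\<^bsub>R\<^esub> r) = \<zero>\<^bsub>R\<^esub>"
        using annihilator_right[of "t \<otimes>\<^bsub>R\<^esub> r" s] s t r by auto
      then have "(u \<otimes>\<^bsub>R\<^esub> t) \<otimes>\<^bsub>R\<^esub> r = \<zero>\<^bsub>R\<^esub>" using t r by (simp add: I.m_assoc)
      then show "r \<in> I" using I_iff r u t S_mult by blast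
    }
  qed
qed

text \<open>A numerator killed by an element of \<open>S\<close> gives the zero fraction, so for the
  annihilator ideal the kernel \<open>loc_ideal R S I\<close> is trivial.\<close>

lemma loc_quot_map_ring_iso:
  assumes "left_den_quotient R S I" "ass_l R S = I"
  shows "loc_quot_map R S I \<in> ring_iso (left_loc R S) (left_loc (R Quot I) ((\<lambda>s. I +>\<^bsub>R\<^esub> s) ` S))"
proof -
  interpret left_den_quotient R S I by fact
  interpret h: ring_hom_ring "left_loc R S" "left_loc (R Quot I) ((\<lambda>s. I +>\<^bsub>R\<^esub> s) ` S)" "loc_quot_map R S I"
    by (rule loc_quot_map_hom)
  have zero: "frac R S s r = \<zero>\<^bsub>left_loc R S\<^esub>" if "s \<in> S" "r \<in> I" for s r
    using that reg.mfrac_eq_zero_iff[of s r] assms(2) unfolding ass_l_def by auto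
  have "loc_ideal R S I = {\<zero>\<^bsub>left_loc R S\<^esub>}"
  proof
    show "loc_ideal R S I \<subseteq> {\<zero>\<^bsub>left_loc R S\<^esub>}"
      using zero unfolding loc_ideal_def by blast
    show "{\<zero>\<^bsub>left_loc R S\<^esub>} \<subseteq> loc_ideal R S I"
      using additive_subgroup.zero_closed[OF ideal.axioms(1)[OF ideal_loc_ideal]] by blast
  qed
  then have "inj_on (loc_quot_map R S I) (carrier (left_loc R S))"
    using h.trivial_ker_imp_inj kernel_loc_quot_map by simp
  then show ?thesis
    using h.homh loc_quot_map_surj unfolding ring_iso_def bij_betw_def by blast
qed

theorem corollary3p4:
  fixes R :: "('a, 'm) ring_scheme" and S I :: "'a set"
    and Rb :: "'a set ring" and Sb :: "'a set set"
  assumes "ring R"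
    and "S \<in> Den_l R I"
    and "semiprime_ideal R I"
    and Rb: "Rb = R Quot I"
    and Sb: "Sb = (\<lambda>s. I +>\<^bsub>R\<^esub> s) ` S"
  shows
    "(loc_quot_map R S I \<in> ring_iso (left_loc R S) (left_loc Rb Sb) \<and>
     (\<forall>s\<in>S. \<forall>r\<in>carrier R.
        loc_quot_map R S I (frac R S s r) = frac Rb Sb (I +>\<^bsub>R\<^esub> s) (I +>\<^bsub>R\<^esub> r)) \<and>
     semiprime_ring (left_loc R S) \<and> semiprime_ring (left_loc Rb Sb)) \<and>
     (finite (min_primes Rb) \<longrightarrow>
       (\<forall>P\<in>min_primes Rb. loc_quot_map R S I ` loc_ideal_pull R S I P = loc_ideal Rb Sb P) \<and>
       min_primes (left_loc R S) = {loc_ideal_pull R S I P | P. P \<in> min_primes Rb} \<and>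
       min_primes (left_loc Rb Sb) = {loc_ideal Rb Sb P | P. P \<in> min_primes Rb} \<and>
       bij_betw (loc_ideal_pull R S I) (min_primes Rb) (min_primes (left_loc R S)) \<and>
       bij_betw (loc_ideal Rb Sb) (min_primes Rb) (min_primes (left_loc Rb Sb)) \<and>
       card (min_primes (left_loc R S)) = card (min_primes Rb)) \<and>
     (finite (min_primes Rb) \<longrightarrow>
       (\<forall>P\<in>min_primes Rb.
          (\<lambda>x. P +>\<^bsub>Rb\<^esub> x) ` Sb \<in> Den_l (Rb Quot P) {\<zero>\<^bsub>Rb Quot P\<^esub>} \<and>
          (\<exists>f \<in> ring_iso (left_loc (Rb Quot P) ((\<lambda>x. P +>\<^bsub>Rb\<^esub> x) ` Sb))
                          (left_loc Rb Sb Quot loc_ideal Rb Sb P).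
             \<forall>s\<in>Sb. \<forall>r\<in>carrier Rb.
               f (frac (Rb Quot P) ((\<lambda>x. P +>\<^bsub>Rb\<^esub> x) ` Sb) (P +>\<^bsub>Rb\<^esub> s) (P +>\<^bsub>Rb\<^esub> r))
                 = loc_ideal Rb Sb P +>\<^bsub>left_loc Rb Sb\<^esub> frac Rb Sb s r) \<and>
          (\<exists>g \<in> left_module_iso (left_loc Rb Sb)
                  (quotient_module (left_loc Rb Sb) (loc_ideal Rb Sb P))
                  (left_loc_module Rb Sb (quotient_module Rb P)).
             \<forall>s\<in>Sb. \<forall>r\<in>carrier Rb.
               g (loc_ideal Rb Sb P +>\<^bsub>left_loc Rb Sb\<^esub> frac Rb Sb s r)
                 = mfrac Rb Sb (quotient_module Rb P) s (P +>\<^bsub>Rb\<^esub> r))))"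
proof -
  have "ideal I R" and sp: "semiprime_ring Rb"
    using assms(3) unfolding semiprime_ideal_def Rb by auto
  then have quot: "left_den_quotient R S I"
    using left_den_quotient_ass assms(1,2) by blast
  then interpret left_den_quotient R S I .
  have iso: "loc_quot_map R S I \<in> ring_iso (left_loc R S) (left_loc Rb Sb)"
    using loc_quot_map_ring_iso[OF quot] assms(2) unfolding Rb Sb Den_l_def by blast
  have "Sb \<in> Den_l Rb {\<zero>\<^bsub>Rb\<^esub>}" using image_Den unfolding Rb Sb .
  then interpret B: left_den_zero Rb Sb
    using ideal.quotient_is_ring[OF \<open>ideal I R\<close>] unfolding Den_l_def Rb[symmetric]
    by (auto simp: left_den_zero_def left_den_def left_den_axioms_def left_den_zero_axioms_def)
  \<comment> \<open>Semiprimeness is established where the denominators are regular and then carried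
    back along the isomorphism.\<close>
  have spB: "semiprime_ring (left_loc Rb Sb)" by (rule B.semiprime_left_loc[OF sp])
  have spA: "semiprime_ring (left_loc R S)" by (rule semiprime_ring_iso[OF ring_left_loc spB iso])
  have frac: "\<forall>s\<in>S. \<forall>r\<in>carrier R.
        loc_quot_map R S I (frac R S s r) = frac Rb Sb (I +>\<^bsub>R\<^esub> s) (I +>\<^bsub>R\<^esub> r)"
    using loc_quot_map_frac unfolding Rb Sb by blast
  have pull: "loc_ideal_pull R S I P
      = vimage_ideal (left_loc R S) (loc_quot_map R S I) (loc_ideal Rb Sb P)" for P
    unfolding Rb Sb by (rule loc_ideal_pull_eq_vimage)
  have primes: "(\<forall>P\<in>min_primes Rb. loc_quot_map R S I ` loc_ideal_pull R S I P = loc_ideal Rb Sb P) \<and>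
       min_primes (left_loc R S) = {loc_ideal_pull R S I P | P. P \<in> min_primes Rb} \<and>
       min_primes (left_loc Rb Sb) = {loc_ideal Rb Sb P | P. P \<in> min_primes Rb} \<and>
       bij_betw (loc_ideal_pull R S I) (min_primes Rb) (min_primes (left_loc R S)) \<and>
       bij_betw (loc_ideal Rb Sb) (min_primes Rb) (min_primes (left_loc Rb Sb)) \<and>
       card (min_primes (left_loc R S)) = card (min_primes Rb)"
    if fin: "finite (min_primes Rb)"
  proof -
    interpret B: left_den_semiprime Rb Sb
      using sp fin by unfold_locales
    have bijB: "bij_betw (loc_ideal Rb Sb) (min_primes Rb) (min_primes (left_loc Rb Sb))"
      by (rule B.bij_betw_loc_min_primes)
    \<comment> \<open>The map is the composite of localizing minimal primes of \<open>Rb\<close>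
      with taking preimages under the isomorphism.\<close>
    have bijA: "bij_betw (loc_ideal_pull R S I) (min_primes Rb) (min_primes (left_loc R S))"
      using bij_betw_trans[OF bijB min_primes_vimage_iso[OF ring_left_loc B.ring_left_loc iso]]
      unfolding o_def pull[symmetric] .
    show ?thesis
    proof (intro conjI ballI bijA bijB)
      fix P assume P: "P \<in> min_primes Rb"
      have "loc_ideal Rb Sb P \<in> min_primes (left_loc Rb Sb)" using bijB P by (rule bij_betw_apply)
      from image_vimage_ideal[OF iso prime_ideal_subset[OF min_primes_prime[OF this]]]
      show "loc_quot_map R S I ` loc_ideal_pull R S I P = loc_ideal Rb Sb P"
        unfolding pull .
    next
      show "min_primes (left_loc R S) = {loc_ideal_pull R S I P | P. P \<in> min_primes Rb}"
        using bij_betw_imp_surj_on[OF bijA] by blast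
      show "min_primes (left_loc Rb Sb) = {loc_ideal Rb Sb P | P. P \<in> min_primes Rb}"
        using bij_betw_imp_surj_on[OF bijB] by blast
      show "card (min_primes (left_loc R S)) = card (min_primes Rb)"
        using bij_betw_same_card[OF bijA] by simp
    qed
  qed
  \<comment> \<open>The same locale, now over \<open>Rb\<close> with \<open>J = P\<close>, supplies
    the denominator set in \<open>Rb Quot P\<close> and both isomorphisms.\<close>
  have quotients: "left_den_quotient Rb Sb P" if "finite (min_primes Rb)" "P \<in> min_primes Rb" for P
    by (rule left_den_semiprime.left_den_quotient_min_prime[OF _ that(2)])
      (use sp that(1) in unfold_locales)
  show ?thesis
    by (intro conjI impI ballI iso frac[rule_format] spA spB primes
        left_den_quotient.image_Den left_den_quotient.left_loc_quotient_iso
        left_den_quotient.left_loc_module_quotient_iso quotients)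
qed

end
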